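(* Let $d\ge4$ be even and let $\mathcal{T}$ be a $\mathcal{G}_{n,d}$-tangle of order $r\ge0$. Then the expected number of occurrences of $\mathcal{T}$ in a random $G\in\mathcal{G}_{n,d}$ is $n^{-r}+O(n^{-r-1})$ as $n\to\infty$, and the probability that $\mathcal{T}$ occurs at least once in $G$ is at least $n^{-r}/c-n^{-2r}/(2c^2)+O(n^{-r-1})$, where $c$ is the number of automorphisms (label-preserving) of the complete pruning of $\mathcal{T}$.
   Context: $\mathcal{G}_{n,d}$: choose independent uniformly random permutations $\pi_1,\dots,\pi_{d/2}$ of $\{1,\dots,n\}$. The graph $G$ on $\{1,\dots,n\}$ has, for each $j$ and $i$, a directed edge $i\to\pi_j(i)$ labelled $\pi_j$ paired with its reverse $\pi_j(i)\to i$ labelled $\pi_j^{-1}$ (a fixed point gives a whole-loop). So $G$ is $\Pi$-labelled, $\Pi=\{\pi_1,\pi_1^{-1},\dots,\pi_{d/2},\pi_{d/2}^{-1}\}$, with reverse edges carrying inverse labels. A labelled graph $H$ occurs in (is contained in) $G$ via a map $\iota$ if $\iota$ is a label-preserving graph homomorphism injective on vertices and edges; the number of occurrences is the number of such $\iota$. A $\mathcal{G}_{n,d}$-tangle is a connected $\Pi$-labelled graph contained in some graph of $\mathcal{G}_{n,d}$ for some $n$. The order of a graph is (number of undirected edges) $-$ (number of vertices), each self-loop counting as one edge. A leaf is a vertex of degree $1$; a complete pruning repeatedly deletes leaves with their incident edges until none remain (the result is unique). *)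

theory Defs
  imports
    "HOL-Probability.Probability"
    "HOL-Library.Landau_Symbols"
    "HOL-Combinatorics.Orbits"
    "Graph_Theory.Digraph_Component"
    "Graph_Theory.Bidirected_Digraph"
begin

text \<open>
  The letters of the alphabet \<open>\<Pi>\<close>: \<open>Perm j\<close> is the formal symbol \<open>\<pi>\<^sub>j\<close> and \<open>PermInv j\<close> is
  \<open>\<pi>\<^sub>j\<close> inverse. They are formal symbols, so they are distinct even where the permutation
  happens to be an involution.
\<close>
datatype pi_label = Perm nat | PermInv nat

fun inv_label :: "pi_label \<Rightarrow> pi_label" where
  "inv_label (Perm j) = PermInv j"
| "inv_label (PermInv j) = Perm j"

definition pi_labels :: "nat \<Rightarrow> pi_label set" where
  "pi_labels d = Perm ` {1..d div 2} \<union> PermInv ` {1..d div 2}"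

text \<open>
  A graph is a directed multigraph whose directed edges are paired by an involution \<open>opp\<close>.
\<close>
record ('v, 'e) pi_graph =
  dg :: "('v, 'e) pre_digraph"
  opp :: "'e \<Rightarrow> 'e"
  lab :: "'e \<Rightarrow> pi_label"

abbreviation gverts :: "('v, 'e) pi_graph \<Rightarrow> 'v set" where "gverts H \<equiv> verts (dg H)"
abbreviation garcs :: "('v, 'e) pi_graph \<Rightarrow> 'e set" where "garcs H \<equiv> arcs (dg H)"

text \<open>
  \<^const>\<open>bidirected_digraph\<close> demands that \<open>opp\<close> has no fixed point among the edges, which the
  labelling forces anyway (a letter is never its own inverse), and that \<open>opp\<close> is the
  identity outside the edges, which only normalises irrelevant values.
\<close>
definition pi_labelled :: "nat \<Rightarrow> ('v, 'e) pi_graph \<Rightarrow> bool" where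
  "pi_labelled d H \<longleftrightarrow>
     bidirected_digraph (dg H) (opp H) \<and>
     (\<forall>a \<in> garcs H. lab H a \<in> pi_labels d \<and> lab H (opp H a) = inv_label (lab H a))"

text \<open>
  The directed edge \<open>(i, Perm j)\<close> is \<open>i \<rightarrow> \<pi>\<^sub>j i\<close>, and \<open>(i, PermInv j)\<close> is its reverse
  \<open>\<pi>\<^sub>j i \<rightarrow> i\<close>; both are named after the argument \<open>i\<close> of \<open>\<pi>\<^sub>j\<close>.
\<close>
definition perm_graph ::
  "nat \<Rightarrow> nat \<Rightarrow> (nat \<Rightarrow> nat \<Rightarrow> nat) \<Rightarrow> (nat, nat \<times> pi_label) pi_graph" where
  "perm_graph n d p =
     \<lparr> dg = \<lparr> verts = {1..n},
              arcs = {1..n} \<times> pi_labels d,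
              tail = (\<lambda>(i, l). case l of Perm j \<Rightarrow> i | PermInv j \<Rightarrow> p j i),
              head = (\<lambda>(i, l). case l of Perm j \<Rightarrow> p j i | PermInv j \<Rightarrow> i) \<rparr>,
       opp = perm_restrict (\<lambda>(i, l). (i, inv_label l)) ({1..n} \<times> pi_labels d),
       lab = snd \<rparr>"

text \<open>
  \<^const>\<open>Pi_pmf\<close> is the product distribution, i.e. the permutations are chosen independently.
\<close>
definition random_graph :: "nat \<Rightarrow> nat \<Rightarrow> (nat, nat \<times> pi_label) pi_graph pmf" where
  "random_graph n d =
     map_pmf (perm_graph n d)
       (Pi_pmf {1..d div 2} id (\<lambda>_. pmf_of_set {p. p permutes {1..n}}))"

text \<open>
  A homomorphism is a pair of a vertex map and an edge map; both are extensional, so that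
  distinct homomorphisms differ on the graph itself and can be counted.
\<close>
definition pi_homs ::
  "('v, 'e) pi_graph \<Rightarrow> ('w, 'f) pi_graph \<Rightarrow> (('v \<Rightarrow> 'w) \<times> ('e \<Rightarrow> 'f)) set" where
  "pi_homs H G =
     {(f, g). f \<in> gverts H \<rightarrow>\<^sub>E gverts G \<and> g \<in> garcs H \<rightarrow>\<^sub>E garcs G \<and>
        (\<forall>a \<in> garcs H.
           tail (dg G) (g a) = f (tail (dg H) a) \<and>
           head (dg G) (g a) = f (head (dg H) a) \<and>
           g (opp H a) = opp G (g a) \<and>
           lab G (g a) = lab H a)}"

definition occurrences ::
  "('v, 'e) pi_graph \<Rightarrow> ('w, 'f) pi_graph \<Rightarrow> (('v \<Rightarrow> 'w) \<times> ('e \<Rightarrow> 'f)) set" where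
  "occurrences H G = {(f, g) \<in> pi_homs H G. inj_on f (gverts H) \<and> inj_on g (garcs H)}"

definition occurs_in :: "('v, 'e) pi_graph \<Rightarrow> ('w, 'f) pi_graph \<Rightarrow> bool" where
  "occurs_in H G \<longleftrightarrow> occurrences H G \<noteq> {}"

definition automorphisms :: "('v, 'e) pi_graph \<Rightarrow> (('v \<Rightarrow> 'v) \<times> ('e \<Rightarrow> 'e)) set" where
  "automorphisms H =
     {(f, g) \<in> pi_homs H H.
        bij_betw f (gverts H) (gverts H) \<and> bij_betw g (garcs H) (garcs H)}"

definition tangle :: "nat \<Rightarrow> ('v, 'e) pi_graph \<Rightarrow> bool" where
  "tangle d T \<longleftrightarrow>
     pi_labelled d T \<and> Digraph_Component.connected (dg T) \<and>
     (\<exists>n. \<exists>G \<in> set_pmf (random_graph n d). occurs_in T G)"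

text \<open>An undirected edge is a pair \<open>{a, opp a}\<close>; in particular a self-loop is one edge.\<close>
definition undirected_edges :: "('v, 'e) pi_graph \<Rightarrow> 'e set set" where
  "undirected_edges H = (\<lambda>a. {a, opp H a}) ` garcs H"

definition graph_order :: "('v, 'e) pi_graph \<Rightarrow> int" where
  "graph_order H = int (card (undirected_edges H)) - int (card (gverts H))"

text \<open>
  In a graph with paired edges the number of directed edges leaving a vertex is its undirected
  degree, with a (whole-)loop contributing 2.
\<close>
definition is_leaf :: "('v, 'e) pi_graph \<Rightarrow> 'v \<Rightarrow> bool" where
  "is_leaf H v \<longleftrightarrow> v \<in> gverts H \<and> out_degree (dg H) v = 1"

definition delete_vertex :: "('v, 'e) pi_graph \<Rightarrow> 'v \<Rightarrow> ('v, 'e) pi_graph" where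
  "delete_vertex H v =
     (let D = pre_digraph.del_vert (dg H) v
      in H \<lparr> dg := D, opp := perm_restrict (opp H) (arcs D) \<rparr>)"

definition prune_step :: "('v, 'e) pi_graph \<Rightarrow> ('v, 'e) pi_graph \<Rightarrow> bool" where
  "prune_step H H' \<longleftrightarrow> (\<exists>v. is_leaf H v \<and> H' = delete_vertex H v)"

definition complete_pruning :: "('v, 'e) pi_graph \<Rightarrow> ('v, 'e) pi_graph \<Rightarrow> bool" where
  "complete_pruning H P \<longleftrightarrow> prune_step\<^sup>*\<^sup>* H P \<and> (\<forall>v. \<not> is_leaf P v)"

lemma complete_pruning_exists:
  assumes "finite (gverts H)"
  shows "\<exists>P. complete_pruning H P"
  using assms
proof (induction "card (gverts H)" arbitrary: H rule: less_induct)
  case less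
  show ?case
  proof (cases "\<exists>v. is_leaf H v")
    case True
    then obtain v where v: "is_leaf H v" by blast
    let ?H = "delete_vertex H v"
    have gv: "gverts ?H = gverts H - {v}"
      by (simp add: delete_vertex_def Let_def pre_digraph.del_vert_def)
    have "card (gverts ?H) < card (gverts H)"
      unfolding gv using v less.prems by (meson card_Diff1_less is_leaf_def)
    moreover have "finite (gverts ?H)" using gv less.prems by simp
    ultimately obtain P where "complete_pruning ?H P" using less.hyps by blast
    moreover have "prune_step H ?H" using v by (auto simp: prune_step_def)
    ultimately have "complete_pruning H P"
      by (auto simp: complete_pruning_def intro: converse_rtranclp_into_rtranclp)
    then show ?thesis ..
  next
    case False
    then show ?thesis by (auto simp: complete_pruning_def)
  qed
qed

lemma inv_label_simps [simp]:
  "inv_label l \<noteq> l" "inv_label (inv_label l) = l" "inv_label l \<in> pi_labels d \<longleftrightarrow> l \<in> pi_labels d"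
  by (cases l; auto simp: pi_labels_def)+

lemma pi_labelled_random_graph:
  assumes "G \<in> set_pmf (random_graph n d)"
  shows "pi_labelled d G"
proof -
  have fin: "finite {p. p permutes {1..n}}"
    by (rule finite_permutations) simp
  have ne: "{p. p permutes {1..n}} \<noteq> {}"
    using permutes_id by blast
  obtain p where G: "G = perm_graph n d p"
    and p: "p \<in> PiE_dflt {1..d div 2} id (\<lambda>_. {p. p permutes {1..n}})"
    using assms set_pmf_of_set[OF ne fin] by (auto simp: random_graph_def set_Pi_pmf)
  have "p j permutes {1..n}" for j
    using p permutes_id by (cases "j \<in> {1..d div 2}") (auto simp: PiE_dflt_def)
  then have "p j i \<in> {1..n} \<longleftrightarrow> i \<in> {1..n}" for i j
    by (rule permutes_in_image)
  then show ?thesis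
    by (auto simp: G pi_labelled_def perm_graph_def perm_restrict_def
        split: pi_label.splits if_splits intro!: bidirected_digraph.intro wf_digraph.intro
        bidirected_digraph_axioms.intro)
qed

end

theory Submission
  imports Defs
begin

text \<open>
  An occurrence of \<open>H\<close> in the graph of \<open>\<pi>\<^sub>1, \<dots>, \<pi>\<^bsub>d/2\<^esub>\<close> is an injective vertex map \<open>f\<close> such that every
  undirected edge of \<open>H\<close> is mapped to a prescribed value \<open>\<pi>\<^sub>j x = y\<close>. If \<open>m\<close> such prescriptions are consistent,
  they hold with probability \<open>n\<^sup>-\<^sup>m (1 + O(1/n))\<close>, and summing over \<open>f\<close> gives the expected number.

  Let \<open>X\<close> and \<open>Y\<close> count the occurrences of \<open>T\<close> and of its pruning \<open>P\<close>. Both have order \<open>r\<close>, and restriction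
  from \<open>T\<close> to \<open>P\<close> is injective on occurrences, so \<open>Y - X\<close> is nonnegative with expectation \<open>O(n\<^sup>-\<^sup>r\<^sup>-\<^sup>1)\<close>;
  it therefore suffices to bound the probability of \<open>Y > 0\<close>. The automorphisms of \<open>P\<close> act freely, so \<open>P\<close> has \<open>Y / c\<close> distinct
  images, and Bonferroni's inequality applies once the expected number of ordered pairs of distinct images is
  known to be at most \<open>n\<^sup>-\<^sup>2\<^sup>r / c\<^sup>2 + O(n\<^sup>-\<^sup>r\<^sup>-\<^sup>1)\<close>. Disjoint pairs give the main term. The union of two distinct
  overlapping images has order at least \<open>r + 1\<close>, because \<open>P\<close> is connected without leaves and its proper
  nonempty subgraphs have order less than \<open>r\<close>.
\<close>

section \<open>Folded graphs and their occurrences\<close>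

text \<open>A triple \<open>(j, x, y)\<close> prescribes that the permutation with index
  \<open>j\<close> sends \<open>x\<close> to \<open>y\<close>. Edges labelled
  \<open>PermInv j\<close> are read backwards, so an edge and its reverse yield one and the same
  triple.\<close>

definition constraint :: "('v, 'e) pi_graph \<Rightarrow> ('v \<Rightarrow> nat) \<Rightarrow> 'e \<Rightarrow> nat \<times> nat \<times> nat" where
  "constraint H f a =
     (case lab H a of
        Perm j \<Rightarrow> (j, f (tail (dg H) a), f (head (dg H) a))
      | PermInv j \<Rightarrow> (j, f (head (dg H) a), f (tail (dg H) a)))"

abbreviation constraints :: "('v, 'e) pi_graph \<Rightarrow> ('v \<Rightarrow> nat) \<Rightarrow> (nat \<times> nat \<times> nat) set" where
  "constraints H f \<equiv> constraint H f ` garcs H"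

definition placements :: "nat \<Rightarrow> ('v, 'e) pi_graph \<Rightarrow> ('v \<Rightarrow> nat) set" where
  "placements n H = {f \<in> gverts H \<rightarrow>\<^sub>E {1..n}. inj_on f (gverts H)}"

definition satisfies :: "(nat \<Rightarrow> nat \<Rightarrow> nat) \<Rightarrow> (nat \<times> nat \<times> nat) set \<Rightarrow> bool" where
  "satisfies p C \<longleftrightarrow> (\<forall>(j, x, y) \<in> C. p j x = y)"

text \<open>Only vertex maps are recorded: in a permutation graph the vertex map of an occurrence
  determines its edge map.\<close>

definition occ_maps :: "nat \<Rightarrow> (nat \<Rightarrow> nat \<Rightarrow> nat) \<Rightarrow> ('v, 'e) pi_graph \<Rightarrow> ('v \<Rightarrow> nat) set" where
  "occ_maps n p H = {f \<in> placements n H. satisfies p (constraints H f)}"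

lemma satisfies_Un: "satisfies p (C \<union> D) \<longleftrightarrow> satisfies p C \<and> satisfies p D"
  unfolding satisfies_def by (rule ball_Un)

lemma satisfies_mono: "satisfies p D \<Longrightarrow> C \<subseteq> D \<Longrightarrow> satisfies p C"
  unfolding satisfies_def by (meson subsetD)

lemma finite_placements: "finite (gverts H) \<Longrightarrow> finite (placements n H)"
  unfolding placements_def by (rule finite_subset[of _ "gverts H \<rightarrow>\<^sub>E {1..n}"]) (auto intro: finite_PiE)

lemma finite_occ_maps: "finite (gverts H) \<Longrightarrow> finite (occ_maps n p H)"
  unfolding occ_maps_def by (simp add: finite_placements)

text \<open>
  Reading a word from a vertex is deterministic, as for folded graphs in the sense of Stallings.
\<close>
locale folded = bidirected_digraph "dg H" "opp H" for H :: "('v, 'e) pi_graph" +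
  fixes d :: nat
  assumes lab_in: "a \<in> garcs H \<Longrightarrow> lab H a \<in> pi_labels d"
    and lab_opp: "a \<in> garcs H \<Longrightarrow> lab H (opp H a) = inv_label (lab H a)"
    and finite_verts: "finite (gverts H)"
    and finite_arcs: "finite (garcs H)"
    and arc_eqI: "\<lbrakk>a \<in> garcs H; b \<in> garcs H; lab H a = lab H b; tail (dg H) a = tail (dg H) b\<rbrakk> \<Longrightarrow> a = b"
begin

lemma constraint_opp: "a \<in> garcs H \<Longrightarrow> constraint H f (opp H a) = constraint H f a"
  by (cases "lab H a") (auto simp: constraint_def lab_opp)

text \<open>Equal triples carry the same index, so the two labels agree up to inversion, and
  replacing \<open>b\<close> by its reverse where necessary aligns the orientations. Two vertex maps
  are allowed so that edges of two placements can be compared.\<close>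

lemma constraint_eqE:
  assumes "b \<in> garcs H" and "constraint H f b = constraint H f' a"
  obtains b' where "b' \<in> garcs H" "b' = b \<or> b' = opp H b" "lab H b' = lab H a"
    "f (tail (dg H) b') = f' (tail (dg H) a)" "f (head (dg H) b') = f' (head (dg H) a)"
proof (cases "lab H b = lab H a")
  case True
  then show thesis
    using assms that[of b] by (cases "lab H a") (auto simp: constraint_def)
next
  case False
  then show thesis
    using assms that[of "opp H b"]
    by (cases "lab H a"; cases "lab H b") (auto simp: constraint_def lab_opp)
qed

lemma constraint_eq_iff:
  assumes "inj_on f (gverts H)" "a \<in> garcs H" "b \<in> garcs H"
  shows "constraint H f a = constraint H f b \<longleftrightarrow> b = a \<or> b = opp H a"
proof
  assume "constraint H f a = constraint H f b"
  then obtain a' where a': "a' \<in> garcs H" "a' = a \<or> a' = opp H a" "lab H a' = lab H b"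
    "f (tail (dg H) a') = f (tail (dg H) b)"
    using constraint_eqE assms(2) by metis
  then have "tail (dg H) a' = tail (dg H) b"
    using assms by (auto dest: inj_onD)
  then show "b = a \<or> b = opp H a"
    using a' arc_eqI assms(3) by blast
qed (use constraint_opp[OF assms(2)] in auto)

text \<open>Each fibre of \<open>\<phi>\<close> on \<open>S\<close> is a pair
  \<open>{a, opp H a}\<close>, and reversal has no fixed point among the edges.\<close>

lemma card_two_to_one:
  assumes "S \<subseteq> garcs H" and "\<And>a. a \<in> S \<Longrightarrow> opp H a \<in> S"
    and "\<And>a b. a \<in> S \<Longrightarrow> b \<in> S \<Longrightarrow> \<phi> a = \<phi> b \<longleftrightarrow> b = a \<or> b = opp H a"
  shows "card S = 2 * card (\<phi> ` S)"
proof -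
  have fin: "finite S"
    using assms(1) finite_arcs finite_subset by blast
  have "card {x. x \<in> S \<and> \<phi> x = y} = 2" if "y \<in> \<phi> ` S" for y
  proof -
    from that obtain a where a: "a \<in> S" "y = \<phi> a" by blast
    have "{x. x \<in> S \<and> \<phi> x = y} = {a, opp H a}"
      using a assms(2,3) by (force simp: eq_commute)
    moreover have "opp H a \<noteq> a" using a assms(1) arev_neq by blast
    ultimately show ?thesis by simp
  qed
  then have "(\<Sum>y\<in>\<phi> ` S. card {x. x \<in> S \<and> \<phi> x = y}) = 2 * card (\<phi> ` S)" by simp
  then show ?thesis
    using sum.image_gen[OF fin, of "\<lambda>_. 1::nat" \<phi>] by simp
qed

lemma card_constraints:
  assumes "inj_on f (gverts H)" "S \<subseteq> garcs H" "\<And>a. a \<in> S \<Longrightarrow> opp H a \<in> S"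
  shows "card S = 2 * card (constraint H f ` S)"
  using assms constraint_eq_iff by (intro card_two_to_one) blast+

lemma card_arcs: "card (garcs H) = 2 * card (undirected_edges H)"
  unfolding undirected_edges_def
  by (rule card_two_to_one) (auto simp: doubleton_eq_iff)

end

section \<open>Connectedness by cuts, and the order of proper subgraphs\<close>

definition conn :: "('v, 'e) pi_graph \<Rightarrow> bool" where
  "conn H \<longleftrightarrow> gverts H \<noteq> {} \<and>
     (\<forall>U. U \<subseteq> gverts H \<and> U \<noteq> {} \<and> U \<noteq> gverts H \<longrightarrow>
        (\<exists>a \<in> garcs H. tail (dg H) a \<in> U \<and> head (dg H) a \<in> gverts H - U))"

context folded
begin

text \<open>A vertex set that no edge leaves is closed under reachability in the symmetric closure,
  because every edge traversed backwards is itself an edge of \<open>H\<close>. The cut form is the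
  one that later arguments apply to sets of vertices.\<close>

lemma conn_if_connected:
  assumes "Digraph_Component.connected (dg H)"
  shows "conn H"
proof -
  let ?S = "mk_symmetric (dg H)"
  have ne: "gverts H \<noteq> {}"
    and reach: "\<And>u v. u \<in> gverts H \<Longrightarrow> v \<in> gverts H \<Longrightarrow> u \<rightarrow>\<^sup>*\<^bsub>?S\<^esub> v"
    using assms by (auto simp: Digraph_Component.connected_def strongly_connected_def)
  have "\<exists>a \<in> garcs H. tail (dg H) a \<in> U \<and> head (dg H) a \<in> gverts H - U"
    if U: "U \<subseteq> gverts H" "U \<noteq> {}" "U \<noteq> gverts H" for U
  proof (rule ccontr)
    assume no: "\<not> ?thesis"
    have step: "y \<in> U" if "(x, y) \<in> parcs ?S" "x \<in> U" for x y
    proof -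
      obtain e where e: "e \<in> garcs H"
        "(x = tail (dg H) e \<and> y = head (dg H) e) \<or> (x = head (dg H) e \<and> y = tail (dg H) e)"
        using \<open>(x, y) \<in> parcs ?S\<close> by (auto simp: parcs_mk_symmetric)
      then obtain a where "a \<in> garcs H" "x = tail (dg H) a" "y = head (dg H) a"
        using tail_arev head_arev arev_in_arcs by metis
      then show ?thesis using no \<open>x \<in> U\<close> by auto
    qed
    obtain x y where xy: "x \<in> U" "y \<in> gverts H" "y \<notin> U" using U by blast
    then have "(x, y) \<in> (parcs ?S)\<^sup>*"
      using reach[of x y] U reachable_rtranclI[of ?S x y] by auto
    then have "y \<in> U"
      by (induction rule: rtrancl_induct) (use xy step in auto)
    then show False using xy by simp
  qed
  then show ?thesis using ne by (auto simp: conn_def)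
qed

lemma conn_arc:
  assumes "conn H" "U \<subseteq> gverts H" "U \<noteq> {}" "U \<noteq> gverts H"
  obtains a where "a \<in> garcs H" "tail (dg H) a \<in> U" "head (dg H) a \<in> gverts H" "head (dg H) a \<notin> U"
  using assms unfolding conn_def by blast

text \<open>Each vertex of \<open>W\<close>, the complement of \<open>V1\<close>, is the tail of at
  least two edges, and some edge runs from \<open>V1\<close> into \<open>W\<close>; none of these
  lies in \<open>A1\<close>. As an undirected edge consists of two directed ones, the inequality
  compares twice the order of the subgraph \<open>(V1, A1)\<close> with twice the order of
  \<open>H\<close>.\<close>

lemma order_subgraph_less:
  assumes "conn H" and leaf: "\<And>v. \<not> is_leaf H v"
    and V1: "V1 \<subseteq> gverts H" "V1 \<noteq> {}" and A1: "A1 \<subseteq> garcs H"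
    and ends: "\<And>a. a \<in> A1 \<Longrightarrow> tail (dg H) a \<in> V1 \<and> head (dg H) a \<in> V1"
    and proper: "V1 \<noteq> gverts H \<or> A1 \<noteq> garcs H"
  shows "card A1 + 2 * card (gverts H) < card (garcs H) + 2 * card V1"
proof -
  define W where "W = gverts H - V1"
  have fin: "finite W" "finite V1" "finite A1"
    using finite_verts finite_arcs V1 A1 finite_subset by (auto simp: W_def)
  have cV: "card (gverts H) = card V1 + card W"
    unfolding W_def using V1 fin finite_verts
    by (simp add: card_Diff_subset card_mono)
  show ?thesis
  proof (cases "W = {}")
    case True
    then have "V1 = gverts H" using V1 W_def by auto
    then show ?thesis
      using proper A1 psubset_card_mono[OF finite_arcs] by auto
  next
    case False
    \<comment> \<open>The set \<open>{w}\<close> is a proper part of the vertices because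
      \<open>V1\<close> is nonempty, so some edge leaves it; the absence of leaves rules out that it
      is the only one.\<close>
    have deg: "2 \<le> card (out_arcs (dg H) w)" if w: "w \<in> W" for w
    proof -
      have wV: "w \<in> gverts H" "gverts H \<noteq> {w}" using w V1 by (auto simp: W_def)
      obtain a where "a \<in> garcs H" "tail (dg H) a = w"
        using conn_arc[OF \<open>conn H\<close>, of "{w}"] wV by auto
      then have "out_arcs (dg H) w \<noteq> {}" by auto
      moreover have "card (out_arcs (dg H) w) \<noteq> 1"
        using leaf[of w] wV by (auto simp: is_leaf_def out_degree_def)
      moreover have "finite (out_arcs (dg H) w)"
        by (rule finite_subset[OF _ finite_arcs]) auto
      ultimately show ?thesis by (metis One_nat_def Suc_1 card_0_eq less_2_cases not_less)
    qed
    \<comment> \<open>The tail of \<open>b\<close> lies in \<open>V1\<close>, so \<open>b\<close> is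
      not among the edges leaving \<open>W\<close>. This one extra edge makes the inequality
      strict.\<close>
    obtain b where b: "b \<in> garcs H" "tail (dg H) b \<in> V1" "head (dg H) b \<in> W"
      using conn_arc[OF \<open>conn H\<close> V1] False V1 by (auto simp: W_def)
    let ?O = "\<Union>w\<in>W. out_arcs (dg H) w"
    have finO: "finite ?O" by (rule finite_subset[OF _ finite_arcs]) auto
    have "card ?O = (\<Sum>w\<in>W. card (out_arcs (dg H) w))"
      by (rule card_UN_disjoint) (use fin in \<open>auto intro: finite_subset[OF _ finite_arcs]\<close>)
    also have "\<dots> \<ge> (\<Sum>w\<in>W. 2)" by (rule sum_mono) (use deg in auto)
    finally have "2 * card W \<le> card ?O" by simp
    moreover have "b \<notin> ?O" using b by (auto simp: W_def)
    ultimately have "2 * card W + 1 \<le> card (insert b ?O)" using finO by simp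
    also have "\<dots> \<le> card (garcs H - A1)"
      by (rule card_mono) (use b ends finite_arcs in \<open>auto simp: W_def\<close>)
    also have "\<dots> = card (garcs H) - card A1"
      using A1 fin by (simp add: card_Diff_subset)
    finally show ?thesis using cV by simp
  qed
qed

end

section \<open>Pruning preserves connectedness and order\<close>

definition subgraph_of :: "('v, 'e) pi_graph \<Rightarrow> ('v, 'e) pi_graph \<Rightarrow> bool" where
  "subgraph_of K H \<longleftrightarrow> gverts K \<subseteq> gverts H \<and> garcs K \<subseteq> garcs H \<and>
     tail (dg K) = tail (dg H) \<and> head (dg K) = head (dg H) \<and> lab K = lab H"

lemma delete_vertex_simps [simp]:
  "gverts (delete_vertex H v) = gverts H - {v}"
  "garcs (delete_vertex H v) = {a \<in> garcs H. tail (dg H) a \<noteq> v \<and> head (dg H) a \<noteq> v}"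
  "tail (dg (delete_vertex H v)) = tail (dg H)"
  "head (dg (delete_vertex H v)) = head (dg H)"
  "lab (delete_vertex H v) = lab H"
  "opp (delete_vertex H v) =
     perm_restrict (opp H) {a \<in> garcs H. tail (dg H) a \<noteq> v \<and> head (dg H) a \<noteq> v}"
  by (simp_all add: delete_vertex_def Let_def pre_digraph.del_vert_def)

context folded
begin

lemma folded_delete_vertex: "folded (delete_vertex H v) d"
proof
  show "a \<in> arcs (dg (delete_vertex H v)) \<longleftrightarrow> opp (delete_vertex H v) a \<noteq> a" for a
    using arev_neq by (auto simp: perm_restrict_def)
qed (use finite_verts finite_arcs in \<open>auto simp: perm_restrict_def lab_in lab_opp intro: arc_eqI\<close>)

text \<open>A leaf disappears together with the two directions of its only edge, which leaves the
  order unchanged. Connectedness survives since each cut of \<open>K\<close> extends to a cut of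
  \<open>H\<close> that does not separate the leaf from its neighbour.\<close>

lemma prune_step_preserves:
  assumes "conn H" "prune_step H K"
  shows "folded K d" "conn K" "subgraph_of K H"
    "card (garcs H) = card (garcs K) + 2" "card (gverts H) = card (gverts K) + 1"
proof -
  obtain v where v: "v \<in> gverts H" "out_degree (dg H) v = 1" and K: "K = delete_vertex H v"
    using assms(2) by (auto simp: prune_step_def is_leaf_def)
  show "folded K d" by (simp add: K folded_delete_vertex)
  show "subgraph_of K H" by (auto simp: K subgraph_of_def)
  obtain a where a: "out_arcs (dg H) v = {a}"
    using v by (auto simp: out_degree_def card_1_singleton_iff)
  then have aH: "a \<in> garcs H" "tail (dg H) a = v" by auto
  have only: "b = a" if "b \<in> garcs H" "tail (dg H) b = v" for b
    using a that by (auto simp: set_eq_iff)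
  define u where "u = head (dg H) a"
  \<comment> \<open>A loop at \<open>v\<close> would have a reverse that also leaves
    \<open>v\<close>, contradicting degree 1.\<close>
  have u: "u \<in> gverts H" "u \<noteq> v"
    using only[of "opp H a"] aH arev_neq by (auto simp: u_def)
  have into: "b = opp H a" if "b \<in> garcs H" "head (dg H) b = v" for b
    using only[of "opp H b"] that by auto
  have "b = a \<or> b = opp H a \<or> b \<in> garcs K" if "b \<in> garcs H" for b
    using only[OF that] into[OF that] that by (auto simp: K)
  moreover have "garcs K \<subseteq> garcs H" "opp H a \<in> garcs H" using aH by (auto simp: K)
  ultimately have "garcs H = insert a (insert (opp H a) (garcs K))"
    using aH by blast
  moreover have "a \<notin> garcs K" "opp H a \<notin> garcs K" "opp H a \<noteq> a"
    using aH arev_neq by (auto simp: K)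
  moreover have "finite (garcs K)" using finite_arcs by (simp add: K)
  ultimately show "card (garcs H) = card (garcs K) + 2" by simp
  show "card (gverts H) = card (gverts K) + 1"
    using card_Suc_Diff1[OF finite_verts v(1)] by (simp add: K)
  \<comment> \<open>The leaf \<open>v\<close> is put on the same side of the cut as its neighbour
    \<open>u\<close>. The crossing edge found in \<open>H\<close> then avoids \<open>v\<close> and
    remains in \<open>K\<close>.\<close>
  have "\<exists>b \<in> garcs K. tail (dg K) b \<in> U \<and> head (dg K) b \<in> gverts K - U"
    if U: "U \<subseteq> gverts K" "U \<noteq> {}" "U \<noteq> gverts K" for U
  proof (cases "u \<in> U")
    case True
    obtain b where b: "b \<in> garcs H" "tail (dg H) b \<in> insert v U"
      "head (dg H) b \<in> gverts H" "head (dg H) b \<notin> insert v U"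
      by (rule conn_arc[OF assms(1), of "insert v U"]) (use U v in \<open>auto simp: K\<close>)
    moreover have "tail (dg H) b \<noteq> v" using only[of b] b True by (auto simp: u_def)
    ultimately have "b \<in> garcs K" "tail (dg K) b \<in> U" "head (dg K) b \<in> gverts K - U"
      by (simp_all add: K)
    then show ?thesis by blast
  next
    case False
    obtain b where b: "b \<in> garcs H" "tail (dg H) b \<in> U"
      "head (dg H) b \<in> gverts H" "head (dg H) b \<notin> U"
      by (rule conn_arc[OF assms(1), of "U"]) (use U v in \<open>auto simp: K\<close>)
    moreover have "head (dg H) b \<noteq> v" using into[of b] b False aH by (auto simp: u_def)
    moreover have "tail (dg H) b \<noteq> v" using b U by (auto simp: K)
    ultimately have "b \<in> garcs K" "tail (dg K) b \<in> U" "head (dg K) b \<in> gverts K - U"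
      by (simp_all add: K)
    then show ?thesis by blast
  qed
  then show "conn K" using u by (auto simp: conn_def K)
qed

end

text \<open>The final equation is the equality of the two orders, doubled to count directed edges
  and rearranged to avoid subtraction of natural numbers.\<close>

lemma pruning_preserves:
  assumes "prune_step\<^sup>*\<^sup>* H P" "folded H d" "conn H"
  shows "folded P d \<and> conn P \<and> subgraph_of P H \<and>
    card (garcs H) + 2 * card (gverts P) = card (garcs P) + 2 * card (gverts H)"
  using assms(1)
proof (induction rule: rtranclp_induct)
  case base
  then show ?case using assms by (simp add: subgraph_of_def)
next
  case (step K P)
  then interpret K: folded K d by simp
  have "conn K" using step by simp
  from K.prune_step_preserves[OF this step(2)] step show ?case
    by (auto simp: subgraph_of_def)
qed

section \<open>Automorphisms, vertex maps of occurrences, and restriction to subgraphs\<close>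

context folded
begin

text \<open>Automorphisms act freely by precomposition, and the orbit of \<open>f1\<close> consists
  of the placements with the same image. Indeed, such a placement \<open>f\<close> differs from
  \<open>f1\<close> by the vertex permutation "\<open>f\<close> followed by the inverse of
  \<open>f1\<close>", whose edge part is recovered from labels and tails.\<close>

lemma card_same_image:
  assumes f1: "f1 \<in> placements n H"
  shows "card {f \<in> placements n H. f ` gverts H = f1 ` gverts H \<and> constraints H f = constraints H f1}
    = card (automorphisms H)"
proof -
  let ?F = "{f \<in> placements n H. f ` gverts H = f1 ` gverts H \<and> constraints H f = constraints H f1}"
  let ?\<Phi> = "\<lambda>(s, t). restrict (f1 \<circ> s) (gverts H)"
  note pl = f1[unfolded placements_def]
  have inj1: "inj_on f1 (gverts H)" and ext1: "f1 \<in> gverts H \<rightarrow>\<^sub>E {1..n}"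
    using pl by auto
  have "bij_betw ?\<Phi> (automorphisms H) ?F"
  proof (rule bij_betwI')
    fix x y assume x: "x \<in> automorphisms H" and y: "y \<in> automorphisms H"
    obtain s t s' t' where xy: "x = (s, t)" "y = (s', t')" by (cases x; cases y)
    show "?\<Phi> x = ?\<Phi> y \<longleftrightarrow> x = y"
    proof
      assume eq: "?\<Phi> x = ?\<Phi> y"
      have S: "s \<in> gverts H \<rightarrow>\<^sub>E gverts H" "s' \<in> gverts H \<rightarrow>\<^sub>E gverts H"
        "t \<in> garcs H \<rightarrow>\<^sub>E garcs H" "t' \<in> garcs H \<rightarrow>\<^sub>E garcs H"
        using x y by (auto simp: xy automorphisms_def pi_homs_def)
      have "s v = s' v" if "v \<in> gverts H" for v
      proof -
        have "f1 (s v) = f1 (s' v)"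
          using fun_cong[OF eq, of v] that by (simp add: xy)
        then show ?thesis using inj1 S that by (meson PiE_mem inj_onD)
      qed
      then have ss: "s = s'" using S by (intro PiE_ext[of s]) auto
      have "t a = t' a" if "a \<in> garcs H" for a
        using that x y S ss by (intro arc_eqI) (auto simp: xy automorphisms_def pi_homs_def)
      then have "t = t'" using S by (intro PiE_ext[of t]) auto
      then show "x = y" using ss xy by simp
    qed simp
  next
    fix x assume x: "x \<in> automorphisms H"
    obtain s t where xy: "x = (s, t)" by (cases x)
    have s: "s \<in> gverts H \<rightarrow>\<^sub>E gverts H" "bij_betw s (gverts H) (gverts H)"
      and t: "bij_betw t (garcs H) (garcs H)"
      and h: "\<And>a. a \<in> garcs H \<Longrightarrow> tail (dg H) (t a) = s (tail (dg H) a) \<and>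
         head (dg H) (t a) = s (head (dg H) a) \<and> lab H (t a) = lab H a"
      using x by (auto simp: xy automorphisms_def pi_homs_def)
    let ?f = "restrict (f1 \<circ> s) (gverts H)"
    have simg: "s ` gverts H = gverts H" and timg: "t ` garcs H = garcs H"
      using s t by (auto simp: bij_betw_def)
    have "?f \<in> placements n H"
      using s ext1 inj1 simg by (auto simp: placements_def bij_betw_def inj_on_def Pi_iff PiE_iff)
    moreover have "?f ` gverts H = f1 ` s ` gverts H"
      by (simp add: image_image)
    then have "?f ` gverts H = f1 ` gverts H"
      by (simp only: simg)
    moreover have "constraint H ?f a = constraint H f1 (t a)" if "a \<in> garcs H" for a
      using that h[OF that] by (simp add: constraint_def split: pi_label.splits)
    then have "constraints H ?f = constraint H f1 ` t ` garcs H"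
      by (auto simp: image_image)
    ultimately show "?\<Phi> x \<in> ?F" by (simp add: xy timg)
  next
    fix f assume "f \<in> ?F"
    then have f: "f \<in> gverts H \<rightarrow>\<^sub>E {1..n}" "inj_on f (gverts H)"
      and img: "f ` gverts H = f1 ` gverts H" and con: "constraints H f = constraints H f1"
      by (auto simp: placements_def)
    define s where "s = (\<lambda>v\<in>gverts H. inv_into (gverts H) f1 (f v))"
    have f1s: "f1 (s v) = f v" "s v \<in> gverts H" if v: "v \<in> gverts H" for v
    proof -
      have "f v \<in> f1 ` gverts H" using v img by blast
      then show "f1 (s v) = f v" "s v \<in> gverts H"
        using v by (simp_all add: s_def f_inv_into_f inv_into_into)
    qed
    \<comment> \<open>The prescription that \<open>f\<close> makes at \<open>a\<close> also comes
      from \<open>f1\<close> at some edge. That edge, suitably oriented, is the image of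
      \<open>a\<close> under the automorphism being built.\<close>
    have "\<exists>b. b \<in> garcs H \<and> lab H b = lab H a \<and> tail (dg H) b = s (tail (dg H) a)
        \<and> head (dg H) b = s (head (dg H) a)" if a: "a \<in> garcs H" for a
    proof -
      have "constraint H f a \<in> constraints H f1" using con a by blast
      then obtain b0 where b0: "constraint H f a = constraint H f1 b0" "b0 \<in> garcs H"
        by (rule imageE)
      obtain b where b: "b \<in> garcs H" "lab H b = lab H a"
        "f1 (tail (dg H) b) = f (tail (dg H) a)" "f1 (head (dg H) b) = f (head (dg H) a)"
        using constraint_eqE[OF b0(2) b0(1)[symmetric]] by blast
      have "tail (dg H) b = s (tail (dg H) a)" "head (dg H) b = s (head (dg H) a)"
        using a b f1s by (simp_all add: inj_on_eq_iff[OF inj1, symmetric])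
      then show ?thesis using b by blast
    qed
    then obtain t0 where t0: "\<And>a. a \<in> garcs H \<Longrightarrow> t0 a \<in> garcs H \<and> lab H (t0 a) = lab H a \<and>
        tail (dg H) (t0 a) = s (tail (dg H) a) \<and> head (dg H) (t0 a) = s (head (dg H) a)"
      by metis
    define t where "t = restrict t0 (garcs H)"
    have t: "t a \<in> garcs H" "lab H (t a) = lab H a" "tail (dg H) (t a) = s (tail (dg H) a)"
      "head (dg H) (t a) = s (head (dg H) a)" if "a \<in> garcs H" for a
      using t0 that by (auto simp: t_def)
    have injs: "inj_on s (gverts H)"
      using f1s f by (metis (no_types, lifting) inj_on_def)
    then have bs: "bij_betw s (gverts H) (gverts H)"
      using f1s finite_verts by (simp add: bij_betw_def endo_inj_surj image_subset_iff)
    have "inj_on t (garcs H)"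
    proof (rule inj_onI)
      fix a b assume ab: "a \<in> garcs H" "b \<in> garcs H" "t a = t b"
      then have "lab H a = lab H b" "s (tail (dg H) a) = s (tail (dg H) b)"
        using t[OF ab(1)] t[OF ab(2)] ab(3) by simp_all
      then show "a = b" using ab injs by (intro arc_eqI) (auto dest: inj_onD)
    qed
    then have bt: "bij_betw t (garcs H) (garcs H)"
      using t finite_arcs by (simp add: bij_betw_def endo_inj_surj image_subset_iff)
    have "t (opp H a) = opp H (t a)" if "a \<in> garcs H" for a
      using that t by (intro arc_eqI) (auto simp: lab_opp)
    then have "(s, t) \<in> automorphisms H"
      using t f1s bs bt by (auto simp: automorphisms_def pi_homs_def s_def t_def)
    moreover have "f = ?\<Phi> (s, t)"
      using f f1s by (auto simp: fun_eq_iff PiE_iff extensional_def)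
    ultimately show "\<exists>x \<in> automorphisms H. f = ?\<Phi> x" by blast
  qed
  then show ?thesis by (simp add: bij_betw_same_card)
qed

text \<open>An edge of the permutation graph is named by its label and the argument of the
  permutation. That argument is the image of the tail for a \<open>Perm\<close> label and of the
  head for a \<open>PermInv\<close> label, which forces the edge map.\<close>

lemma occurrences_perm_graph_iff:
  assumes perm: "\<And>j. p j permutes {1..n}"
  shows "(f, g) \<in> occurrences H (perm_graph n d p) \<longleftrightarrow> f \<in> occ_maps n p H \<and>
    g = (\<lambda>a\<in>garcs H. (case lab H a of Perm j \<Rightarrow> f (tail (dg H) a) | PermInv j \<Rightarrow> f (head (dg H) a), lab H a))"
    (is "?L \<longleftrightarrow> ?R \<and> g = ?g")
proof
  assume L: ?L
  then have f: "f \<in> gverts H \<rightarrow>\<^sub>E {1..n}" "inj_on f (gverts H)"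
    and g: "g \<in> garcs H \<rightarrow>\<^sub>E {1..n} \<times> pi_labels d"
    and h: "\<And>a. a \<in> garcs H \<Longrightarrow> tail (dg (perm_graph n d p)) (g a) = f (tail (dg H) a) \<and>
           head (dg (perm_graph n d p)) (g a) = f (head (dg H) a) \<and>
           lab (perm_graph n d p) (g a) = lab H a"
    by (auto simp: occurrences_def pi_homs_def perm_graph_def)
  have ga: "g a = ?g a \<and> satisfies p {constraint H f a}" if "a \<in> garcs H" for a
    using h[OF that] that
    by (cases "g a"; cases "lab H a") (auto simp: perm_graph_def constraint_def satisfies_def)
  have "g = ?g" using ga g by (auto simp: fun_eq_iff PiE_iff extensional_def)
  moreover have ?R using f ga by (auto simp: occ_maps_def placements_def satisfies_def)
  ultimately show "?R \<and> g = ?g" by blast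
next
  assume R: "?R \<and> g = ?g"
  have f: "f \<in> gverts H \<rightarrow>\<^sub>E {1..n}" "inj_on f (gverts H)"
    and sat: "\<And>a. a \<in> garcs H \<Longrightarrow> satisfies p {constraint H f a}"
    using R by (auto simp: occ_maps_def placements_def satisfies_def)
  have fin: "f v \<in> {1..n}" if "v \<in> gverts H" for v
    using f that by (auto simp: PiE_iff)
  have hom: "tail (dg (perm_graph n d p)) (?g a) = f (tail (dg H) a) \<and>
           head (dg (perm_graph n d p)) (?g a) = f (head (dg H) a) \<and>
           ?g (opp H a) = opp (perm_graph n d p) (?g a) \<and>
           lab (perm_graph n d p) (?g a) = lab H a \<and> ?g a \<in> {1..n} \<times> pi_labels d"
    if a: "a \<in> garcs H" for a
    using sat[OF a] a lab_in[OF a] fin[of "head (dg H) a"] fin[of "tail (dg H) a"]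
    by (cases "lab H a")
      (auto simp: perm_graph_def constraint_def satisfies_def lab_opp perm_restrict_def pi_labels_def)
  define g0 where "g0 = ?g"
  note hom = hom[folded g0_def]
  have "inj_on g0 (garcs H)"
  proof (rule inj_onI)
    fix a b assume ab: "a \<in> garcs H" "b \<in> garcs H" "g0 a = g0 b"
    then have "lab H a = lab H b" "f (tail (dg H) a) = f (tail (dg H) b)"
      using hom by metis+
    then show "a = b" using ab f(2) by (intro arc_eqI) (auto dest: inj_onD)
  qed
  moreover have "gverts (perm_graph n d p) = {1..n}" "garcs (perm_graph n d p) = {1..n} \<times> pi_labels d"
    by (auto simp: perm_graph_def)
  moreover have "g0 \<in> extensional (garcs H)" by (simp add: g0_def)
  ultimately have "(f, g0) \<in> occurrences H (perm_graph n d p)"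
    using f hom by (auto simp: occurrences_def pi_homs_def PiE_iff)
  then show ?L using R by (simp add: g0_def)
qed

lemma card_occurrences_perm_graph:
  assumes perm: "\<And>j. p j permutes {1..n}"
  shows "card (occurrences H (perm_graph n d p)) = card (occ_maps n p H)"
proof -
  define E where "E = (\<lambda>f :: 'v \<Rightarrow> nat. \<lambda>a\<in>garcs H. (case lab H a of
    Perm j \<Rightarrow> f (tail (dg H) a) | PermInv j \<Rightarrow> f (head (dg H) a), lab H a))"
  have "occurrences H (perm_graph n d p) = (\<lambda>f. (f, E f)) ` occ_maps n p H"
    using occurrences_perm_graph_iff[of p n, OF perm] by (auto simp: E_def)
  then show ?thesis by (simp add: card_image inj_on_def)
qed

text \<open>No edge leaves the set \<open>U\<close> of agreement: the value at one end of an edge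
  determines the value at the other, by applying the permutation or, for \<open>PermInv\<close>, by
  its injectivity. Connectedness makes \<open>U\<close> everything.\<close>

lemma occ_maps_agree:
  assumes "conn H" and perm: "\<And>j. p j permutes {1..n}"
    and f: "f \<in> occ_maps n p H" and g: "g \<in> occ_maps n p H"
    and v: "v \<in> gverts H" "f v = g v"
  shows "f = g"
proof -
  define U where "U = {x \<in> gverts H. f x = g x}"
  have "U = gverts H"
  proof (rule ccontr)
    assume "U \<noteq> gverts H"
    moreover have "U \<subseteq> gverts H" "U \<noteq> {}" using v by (auto simp: U_def)
    ultimately obtain a where a: "a \<in> garcs H" "tail (dg H) a \<in> U" "head (dg H) a \<in> gverts H"
      "head (dg H) a \<notin> U"
      using conn_arc[OF \<open>conn H\<close>, of U] by blast
    have "satisfies p {constraint H f a}" "satisfies p {constraint H g a}"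
      using f g a(1) by (auto simp: occ_maps_def satisfies_def)
    then have "f (head (dg H) a) = g (head (dg H) a)"
      using a(1,2) inj_eq[OF permutes_inj[OF perm]] by (cases "lab H a")
        (auto simp: constraint_def satisfies_def U_def, metis)
    then show False using a by (auto simp: U_def)
  qed
  then show ?thesis
    using f g by (intro PiE_ext[of f "gverts H" "\<lambda>_. {1..n}"])
      (auto simp: occ_maps_def placements_def U_def)
qed

text \<open>Restriction to the vertices of \<open>K\<close> is injective on occurrences, since two
  occurrences of a connected graph that agree at one vertex are equal.\<close>

lemma card_occ_maps_subgraph:
  assumes "conn H" and perm: "\<And>j. p j permutes {1..n}"
    and K: "subgraph_of K H" "gverts K \<noteq> {}" and "finite (gverts K)"
    and wf: "wf_digraph (dg K)"
  shows "card (occ_maps n p H) \<le> card (occ_maps n p K)"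
proof (rule card_inj_on_le)
  let ?r = "\<lambda>f. restrict f (gverts K)"
  show "inj_on ?r (occ_maps n p H)"
  proof (rule inj_onI)
    fix f g assume fg: "f \<in> occ_maps n p H" "g \<in> occ_maps n p H" "?r f = ?r g"
    obtain v where v: "v \<in> gverts K" using K by blast
    then have "f v = g v" using fun_cong[OF fg(3), of v] by simp
    then show "f = g" using occ_maps_agree[OF assms(1) perm fg(1,2)] v K
      by (auto simp: subgraph_of_def)
  qed
  show "?r ` occ_maps n p H \<subseteq> occ_maps n p K"
  proof (clarify)
    fix f assume f: "f \<in> occ_maps n p H"
    have KH: "gverts K \<subseteq> gverts H" "garcs K \<subseteq> garcs H" using K by (auto simp: subgraph_of_def)
    have "constraint K (?r f) a = constraint H f a" if "a \<in> garcs K" for a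
      using that wf_digraph.wellformed[OF wf that] K
      by (auto simp: constraint_def subgraph_of_def split: pi_label.splits)
    then have "constraints K (?r f) \<subseteq> constraints H f" using KH by force
    moreover have "?r f \<in> placements n K"
      using f KH by (auto simp: occ_maps_def placements_def intro: inj_on_subset)
    ultimately show "?r f \<in> occ_maps n p K"
      using f by (auto simp: occ_maps_def intro: satisfies_mono)
  qed
  show "finite (occ_maps n p K)" using assms by (simp add: finite_occ_maps)
qed

end

section \<open>Random permutations with prescribed values\<close>

text \<open>The solutions form a coset: they are the compositions of \<open>p0\<close> with the
  permutations that fix every first component of \<open>Q\<close>.\<close>

lemma card_permutes_satisfying:
  fixes Q :: "('a \<times> 'a) set"
  assumes S: "finite S" and Q: "Q \<subseteq> S \<times> S"
    and p0: "p0 permutes S" "\<And>x y. (x, y) \<in> Q \<Longrightarrow> p0 x = y"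
  shows "card {p. p permutes S \<and> (\<forall>(x, y) \<in> Q. p x = y)} = fact (card S - card Q)" (is "?c")
    and "card Q \<le> card S"
proof -
  let ?A = "fst ` Q"
  have A: "?A \<subseteq> S" using Q by auto
  have finA: "finite ?A" using A S finite_subset by blast
  have cQ: "card ?A = card Q"
    by (rule card_image, rule inj_onI) (metis p0(2) prod.collapse)
  show "card Q \<le> card S"
    using card_mono[OF S A] cQ by simp
  have inv: "inv p0 permutes S" using p0 by (simp add: permutes_inv)
  have "bij_betw (\<lambda>q. p0 \<circ> q) {q. q permutes (S - ?A)} {p. p permutes S \<and> (\<forall>(x, y) \<in> Q. p x = y)}"
  proof (rule bij_betwI[where g = "\<lambda>p. inv p0 \<circ> p"])
    show "(\<lambda>q. p0 \<circ> q) \<in> {q. q permutes (S - ?A)} \<rightarrow> {p. p permutes S \<and> (\<forall>(x, y) \<in> Q. p x = y)}"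
    proof (clarsimp, intro conjI)
      fix q assume q: "q permutes (S - ?A)"
      show "p0 \<circ> q permutes S"
        by (rule permutes_compose[OF permutes_subset[OF q] p0(1)]) simp
      have "q x = x" if "(x, y) \<in> Q" for x y
        using permutes_not_in[OF q, of x] that by force
      then show "\<forall>x\<in>Q. case x of (x, y) \<Rightarrow> p0 (q x) = y" using p0(2) by force
    qed
    show "(\<lambda>p. inv p0 \<circ> p) \<in> {p. p permutes S \<and> (\<forall>(x, y) \<in> Q. p x = y)} \<rightarrow> {q. q permutes (S - ?A)}"
    proof clarify
      fix p assume p: "p permutes S" "\<forall>(x, y) \<in> Q. p x = y"
      have 1: "inv p0 \<circ> p permutes S" by (rule permutes_compose[OF p(1) inv])
      have 2: "inv p0 (p x) = x" if "x \<in> ?A" for x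
        using that p(2) p0 by (force simp: permutes_inverses(2))
      show "inv p0 \<circ> p permutes (S - ?A)"
        by (rule permutes_superset[OF 1]) (use 2 in auto)
    qed
  qed (use permutes_inv_o[OF p0(1)] in \<open>auto simp: fun_eq_iff\<close>)
  then have "card {p. p permutes S \<and> (\<forall>(x, y) \<in> Q. p x = y)} = card {q. q permutes (S - ?A)}"
    by (rule bij_betw_same_card[symmetric])
  also have "\<dots> = fact (card (S - ?A))"
    by (rule card_permutations) (use S in auto)
  also have "card (S - ?A) = card S - card Q"
    using card_Diff_subset[OF finA A] cQ by simp
  finally show ?c .
qed

text \<open>The complements in \<open>S\<close> of the domain and of the range of \<open>Q\<close>
  have equal size, so any bijection between them completes the partial injection.\<close>

lemma partial_injection_extends:
  fixes Q :: "('a \<times> 'a) set"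
  assumes S: "finite S" and Q: "Q \<subseteq> S \<times> S"
    and inj: "\<And>x y x' y'. (x, y) \<in> Q \<Longrightarrow> (x', y') \<in> Q \<Longrightarrow> x = x' \<longleftrightarrow> y = y'"
  obtains p where "p permutes S" "\<And>x y. (x, y) \<in> Q \<Longrightarrow> p x = y"
proof -
  let ?A = "fst ` Q" and ?B = "snd ` Q"
  define h where "h x = (THE y. (x, y) \<in> Q)" for x
  have h: "h x = y" if "(x, y) \<in> Q" for x y
    unfolding h_def using that inj by (intro the_equality) auto
  have AB: "?A \<subseteq> S" "?B \<subseteq> S" using Q by auto
  then have "finite ?A" "finite ?B" using S finite_subset by blast+
  have "inj_on h ?A"
  proof (rule inj_onI)
    fix x x' assume "x \<in> ?A" "x' \<in> ?A" "h x = h x'"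
    then obtain y y' where "(x, y) \<in> Q" "(x', y') \<in> Q" "y = y'" using h by force
    then show "x = x'" using inj by blast
  qed
  moreover have "h ` ?A = ?B" using h by force
  ultimately have bij: "bij_betw h ?A ?B" by (simp add: bij_betw_def)
  then have "card (S - ?A) = card (S - ?B)"
    using AB \<open>finite ?A\<close> \<open>finite ?B\<close> by (simp add: card_Diff_subset bij_betw_same_card)
  then obtain k where k: "bij_betw k (S - ?A) (S - ?B)"
    using finite_same_card_bij S by (metis finite_Diff)
  define p where "p x = (if x \<in> ?A then h x else if x \<in> S then k x else x)" for x
  have "bij_betw (\<lambda>x. if x \<in> ?A then h x else k x) (?A \<union> (S - ?A)) (?B \<union> (S - ?B))"
    by (rule bij_betw_disjoint_Un[OF bij k]) auto
  moreover have "?A \<union> (S - ?A) = S" "?B \<union> (S - ?B) = S" using AB by auto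
  ultimately have "bij_betw (\<lambda>x. if x \<in> ?A then h x else k x) S S" by simp
  then have "bij_betw p S S"
    by (rule bij_betw_cong[THEN iffD1, rotated]) (auto simp: p_def)
  then have "p permutes S"
    by (rule bij_imp_permutes) (use AB in \<open>auto simp: p_def\<close>)
  moreover have "p x = y" if "(x, y) \<in> Q" for x y
    using h[OF that] that by (force simp: p_def)
  ultimately show thesis using that by blast
qed

text \<open>The quotient of \<open>fact n\<close> by \<open>fact (n - m)\<close> is a product of
  \<open>m\<close> factors between \<open>n - M\<close> and \<open>n\<close>. The uniform base
  \<open>n - M\<close> lets the bounds for several permutations be multiplied.\<close>

lemma fact_bounds:
  assumes "m \<le> M" "M < n"
  shows "fact n \<le> n ^ m * (fact (n - m) :: nat)" and "(n - M) ^ m * fact (n - m) \<le> (fact n :: nat)"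
proof -
  have "fact n \<le> n ^ m * (fact (n - m) :: nat) \<and> (n - M) ^ m * fact (n - m) \<le> (fact n :: nat)"
    using assms(1)
  proof (induction m)
    case (Suc m)
    have f: "(fact (n - m) :: nat) = (n - m) * fact (n - Suc m)"
      using Suc.prems assms(2) fact_reduce[of "n - m", where 'a = nat] by simp
    have "fact n \<le> n ^ m * ((n - m) * fact (n - Suc m) :: nat)"
      using Suc f by simp
    also have "\<dots> \<le> n ^ m * (n * fact (n - Suc m))" by (intro mult_mono) auto
    finally have 1: "fact n \<le> n ^ Suc m * (fact (n - Suc m) :: nat)" by (simp add: algebra_simps)
    have "(n - M) ^ Suc m * fact (n - Suc m) = (n - M) ^ m * ((n - M) * fact (n - Suc m) :: nat)"
      by simp
    also have "\<dots> \<le> (n - M) ^ m * ((n - m) * fact (n - Suc m))"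
      using Suc.prems by (intro mult_mono) auto
    also have "\<dots> \<le> fact n" using Suc f by simp
    finally show ?case using 1 by simp
  qed simp
  then show "fact n \<le> n ^ m * (fact (n - m) :: nat)" and "(n - M) ^ m * fact (n - m) \<le> (fact n :: nat)"
    by auto
qed

section \<open>Probabilities for independent uniform permutations\<close>

definition random_perms :: "nat \<Rightarrow> nat \<Rightarrow> (nat \<Rightarrow> nat \<Rightarrow> nat) pmf" where
  "random_perms n d = Pi_pmf {1..d div 2} id (\<lambda>_. pmf_of_set {p. p permutes {1..n}})"

lemma random_graph_random_perms: "random_graph n d = map_pmf (perm_graph n d) (random_perms n d)"
  by (simp add: random_graph_def random_perms_def)

lemma finite_perms: "finite {p. p permutes {1..n::nat}}" "{p. p permutes {1..n::nat}} \<noteq> {}"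
  by (rule finite_permutations, simp) (use permutes_id in blast)

lemma set_random_perms:
  "set_pmf (random_perms n d) = PiE_dflt {1..d div 2} id (\<lambda>_. {p. p permutes {1..n}})"
  by (simp add: random_perms_def set_Pi_pmf set_pmf_of_set[OF finite_perms(2,1)] comp_def
      del: One_nat_def)

lemma finite_set_random_perms: "finite (set_pmf (random_perms n d))"
  unfolding set_random_perms by (intro finite_PiE_dflt finite_perms) simp

lemma permutes_random_perms:
  assumes "p \<in> set_pmf (random_perms n d)"
  shows "p j permutes {1..n}"
  using assms permutes_id unfolding set_random_perms
  by (cases "j \<in> {1..d div 2}") (auto simp: PiE_dflt_def)

text \<open>The event is a conjunction of conditions on the single permutations, so independence
  turns its probability into a product of relative counts.\<close>

lemma prob_satisfies_eq:
  assumes C: "C \<subseteq> {1..d div 2} \<times> {1..n} \<times> {1..n}"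
  shows "measure_pmf.prob (random_perms n d) {p. satisfies p C} =
    (\<Prod>j\<in>{1..d div 2}. real (card {q. q permutes {1..n} \<and> (\<forall>(x, y) \<in> C `` {j}. q x = y)}) / fact n)"
proof -
  have "{p. satisfies p C} = Pi {1..d div 2} (\<lambda>j. {q. \<forall>(x, y) \<in> C `` {j}. q x = y})"
  proof (intro equalityI subsetI)
    fix p assume p: "p \<in> Pi {1..d div 2} (\<lambda>j. {q. \<forall>(x, y) \<in> C `` {j}. q x = y})"
    have "p j x = y" if "(j, x, y) \<in> C" for j x y
    proof -
      have j: "j \<in> {1..d div 2}" and xy: "(x, y) \<in> C `` {j}" using that C by auto
      have "\<forall>(x, y) \<in> C `` {j}. p j x = y" using Pi_mem[OF p j] by simp
      from bspec[OF this xy] show ?thesis by simp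
    qed
    then show "p \<in> {p. satisfies p C}" by (auto simp: satisfies_def)
  qed (auto simp: satisfies_def)
  then show ?thesis
    unfolding random_perms_def
    by (simp add: measure_Pi_pmf_Pi measure_pmf_of_set[OF finite_perms(2,1)] Collect_conj_eq
        card_permutations del: One_nat_def)
qed

lemma card_constraint_set:
  assumes "C \<subseteq> J \<times> B" "finite J" "finite B"
  shows "card C = (\<Sum>j\<in>J. card (C `` {j}))"
proof -
  have "C = Sigma J (\<lambda>j. C `` {j})" using assms(1) by auto
  moreover have "card (Sigma J (\<lambda>j. C `` {j})) = (\<Sum>j\<in>J. card (C `` {j}))"
    by (intro card_SigmaI ballI finite_subset[OF _ assms(3)]) (use assms in auto)
  ultimately show ?thesis by simp
qed

text \<open>For each index the prescriptions are either inconsistent, giving a factor 0, or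
  satisfied by exactly \<open>fact (n - m)\<close> permutations. Both cases matter, since the union
  of the prescriptions of two placements can be inconsistent.\<close>

lemma prob_satisfies_le:
  assumes C: "C \<subseteq> {1..d div 2} \<times> {1..n} \<times> {1..n}" and M: "card C \<le> M" "M < n"
  shows "measure_pmf.prob (random_perms n d) {p. satisfies p C} \<le> 1 / real (n - M) ^ card C"
proof -
  note cC = card_constraint_set[OF C finite_atLeastAtMost, simplified]
  have "real (card {q. q permutes {1..n} \<and> (\<forall>(x, y) \<in> C `` {j}. q x = y)}) / fact n
      \<le> (1 / real (n - M)) ^ card (C `` {j})" (is "?l \<le> ?r") if j: "j \<in> {1..d div 2}" for j
  proof (cases "{q. q permutes {1..n} \<and> (\<forall>(x, y) \<in> C `` {j}. q x = y)} = {}")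
    case False
    then obtain p0 where "p0 \<in> {q. q permutes {1..n} \<and> (\<forall>(x, y) \<in> C `` {j}. q x = y)}" by blast
    then have p0: "p0 permutes {1..n}" and sat: "\<forall>(x, y) \<in> C `` {j}. p0 x = y" by simp_all
    have p0': "p0 x = y" if "(x, y) \<in> C `` {j}" for x y using bspec[OF sat that] by simp
    have Q: "C `` {j} \<subseteq> {1..n} \<times> {1..n}" using C by auto
    have "card (C `` {j}) \<le> card C"
      unfolding cC by (rule member_le_sum) (use j in auto)
    then have "(n - M) ^ card (C `` {j}) * fact (n - card (C `` {j})) \<le> (fact n :: nat)"
      using fact_bounds(2)[of "card (C `` {j})" M n] M by simp
    then have "real (n - M) ^ card (C `` {j}) * fact (n - card (C `` {j})) \<le> fact n"
      by (metis of_nat_fact of_nat_le_iff of_nat_mult of_nat_power)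
    then show ?thesis
      using M card_permutes_satisfying(1)[OF _ Q p0 p0'] by (simp add: field_simps power_one_over)
  next
    case True
    show ?thesis unfolding True by simp
  qed
  then have "measure_pmf.prob (random_perms n d) {p. satisfies p C}
      \<le> (\<Prod>j\<in>{1..d div 2}. (1 / real (n - M)) ^ card (C `` {j}))"
    unfolding prob_satisfies_eq[OF C] by (intro prod_mono) auto
  also have "\<dots> = 1 / real (n - M) ^ card C"
    by (subst power_sum[symmetric]) (simp add: cC power_one_over)
  finally show ?thesis .
qed

text \<open>Consistency supplies, for each index, a permutation with the prescribed values. The
  count is then exactly \<open>fact (n - m)\<close>, which is at least \<open>fact n\<close> divided
  by \<open>n ^ m\<close>.\<close>

lemma prob_satisfies_ge:
  assumes C: "C \<subseteq> {1..d div 2} \<times> {1..n} \<times> {1..n}" and n: "card C < n"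
    and inj: "\<And>j x y x' y'. (j, x, y) \<in> C \<Longrightarrow> (j, x', y') \<in> C \<Longrightarrow> x = x' \<longleftrightarrow> y = y'"
  shows "1 / real n ^ card C \<le> measure_pmf.prob (random_perms n d) {p. satisfies p C}"
proof -
  note cC = card_constraint_set[OF C finite_atLeastAtMost, simplified]
  have "(1 / real n) ^ card (C `` {j}) \<le>
      real (card {q. q permutes {1..n} \<and> (\<forall>(x, y) \<in> C `` {j}. q x = y)}) / fact n"
    if j: "j \<in> {1..d div 2}" for j
  proof -
    have Q: "C `` {j} \<subseteq> {1..n} \<times> {1..n}" using C by auto
    obtain p0 where p0: "p0 permutes {1..n}" "\<And>x y. (x, y) \<in> C `` {j} \<Longrightarrow> p0 x = y"
      using partial_injection_extends[OF _ Q] inj by auto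
    have "card (C `` {j}) \<le> card C"
      unfolding cC by (rule member_le_sum) (use j in auto)
    then have "fact n \<le> n ^ card (C `` {j}) * (fact (n - card (C `` {j})) :: nat)"
      using fact_bounds(1)[of "card (C `` {j})" "card C" n] n by simp
    then have "fact n \<le> real n ^ card (C `` {j}) * fact (n - card (C `` {j}))"
      by (metis of_nat_fact of_nat_le_iff of_nat_mult of_nat_power)
    then show ?thesis
      using n card_permutes_satisfying(1)[OF _ Q p0] by (simp add: field_simps power_one_over)
  qed
  then have "(\<Prod>j\<in>{1..d div 2}. (1 / real n) ^ card (C `` {j}))
      \<le> measure_pmf.prob (random_perms n d) {p. satisfies p C}"
    unfolding prob_satisfies_eq[OF C] by (intro prod_mono) auto
  moreover have "(\<Prod>j\<in>{1..d div 2}. (1 / real n) ^ card (C `` {j})) = 1 / real n ^ card C"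
    by (subst power_sum[symmetric]) (simp add: cC power_one_over)
  ultimately show ?thesis by simp
qed

section \<open>Expected counts, injections and power estimates\<close>

lemma expectation_card:
  assumes "finite A" "finite (set_pmf M)"
  shows "measure_pmf.expectation M (\<lambda>p. real (card {x \<in> A. Q p x})) =
    (\<Sum>x\<in>A. measure_pmf.prob M {p. Q p x})"
proof -
  have "real (card {x \<in> A. Q p x}) = (\<Sum>x\<in>A. indicat_real {p. Q p x} p)" for p
    using assms(1) by (simp add: indicator_def sum.If_cases Collect_conj_eq Int_commute)
  then show ?thesis
    using assms by (simp add: Bochner_Integration.integral_sum integrable_measure_pmf_finite)
qed

lemma card_inj_funcset_ge:
  assumes "finite S" "finite T" "card S \<le> c"
  shows "(card T - c) ^ card S \<le> card {f \<in> S \<rightarrow>\<^sub>E T. inj_on f S}"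
  using assms(1,3)
proof (induction S)
  case (insert x S)
  let ?I = "\<lambda>S. {f \<in> S \<rightarrow>\<^sub>E T. inj_on f S}"
  have fin: "finite (?I S)" if "finite S" for S
    by (rule finite_subset[of _ "S \<rightarrow>\<^sub>E T"]) (use that assms(2) in \<open>auto intro: finite_PiE\<close>)
  have "(card T - c) ^ card (insert x S) = (card T - c) ^ card S * (card T - c)"
    using insert by simp
  also have "\<dots> \<le> card (?I S) * (card T - c)"
    using insert by (intro mult_mono) auto
  also have "\<dots> = (\<Sum>g\<in>?I S. card T - c)" by simp
  also have "\<dots> \<le> (\<Sum>g\<in>?I S. card (T - g ` S))"
  proof (rule sum_mono)
    fix g assume "g \<in> ?I S"
    then have "card (g ` S) = card S" "g ` S \<subseteq> T" by (auto simp: card_image)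
    then show "card T - c \<le> card (T - g ` S)"
      using insert by (simp add: card_Diff_subset)
  qed
  also have "\<dots> = card (Sigma (?I S) (\<lambda>g. T - g ` S))"
    using fin[OF insert.hyps(1)] assms(2) by (subst card_SigmaI) auto
  also have "\<dots> \<le> card (?I (insert x S))"
  proof (rule card_inj_on_le[where f = "\<lambda>(g, y). g(x := y)"])
    show "inj_on (\<lambda>(g, y). g(x := y)) (Sigma (?I S) (\<lambda>g. T - g ` S))"
    proof (rule inj_onI, clarify)
      fix g y g' y' assume g: "g \<in> S \<rightarrow>\<^sub>E T" "g' \<in> S \<rightarrow>\<^sub>E T" and eq: "g(x := y) = g'(x := y')"
      have "g z = g' z" for z
        using fun_cong[OF eq, of z] g insert.hyps(2)
        by (cases "z = x") (auto simp: PiE_iff extensional_def)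
      then show "g = g' \<and> y = y'" using fun_cong[OF eq, of x] by auto
    qed
    show "(\<lambda>(g, y). g(x := y)) ` Sigma (?I S) (\<lambda>g. T - g ` S) \<subseteq> ?I (insert x S)"
    proof clarify
      fix g y assume g: "g \<in> S \<rightarrow>\<^sub>E T" "inj_on g S" "y \<in> T" "y \<notin> g ` S"
      have "inj_on (g(x := y)) (insert x S)"
        using g insert.hyps(2) by (auto simp: inj_on_fun_updI fun_upd_image)
      then show "g(x := y) \<in> insert x S \<rightarrow>\<^sub>E T \<and> inj_on (g(x := y)) (insert x S)"
        using g by (simp add: PiE_fun_upd)
    qed
    show "finite (?I (insert x S))"
      by (rule finite_subset[of _ "insert x S \<rightarrow>\<^sub>E T"])
        (use insert assms(2) in \<open>auto intro: finite_PiE\<close>)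
  qed
  finally show ?case .
qed simp

text \<open>With \<open>x = k\<^sup>2 / n\<close>, Bernoulli's inequality bounds the ratio of
  \<open>(n - k) ^ m\<close> to \<open>n ^ m\<close> below by \<open>1 - x\<close>. The hypothesis
  on \<open>n\<close> gives \<open>x \<le> 1/2\<close>, where the reciprocal of \<open>1 - x\<close>
  is at most \<open>1 + 2 * x\<close>.\<close>

lemma inverse_power_le:
  assumes n: "2 * k\<^sup>2 \<le> n" "1 \<le> n" and m: "m \<le> k"
  shows "1 / real (n - k) ^ m \<le> (1 + 2 * real k ^ 2 / real n) / real n ^ m"
    and "1 / real (n - k) ^ m \<le> 2 / real n ^ m"
proof -
  have kn: "k < n"
    using n by (cases k) (auto simp: power2_eq_square)
  define x where "x = real k ^ 2 / real n"
  have x: "0 \<le> x" "x \<le> 1 / 2"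
  proof -
    have "real (2 * k\<^sup>2) \<le> real n" using n(1) by (simp only: of_nat_le_iff)
    then show "x \<le> 1 / 2" using n(2) by (simp add: x_def field_simps)
  qed (simp add: x_def)
  have "real m * real k / real n \<le> x"
    unfolding x_def power2_eq_square using m by (intro divide_right_mono mult_right_mono) auto
  then have "1 - x \<le> 1 + real m * (- (real k / real n))" by simp
  also have "\<dots> \<le> (1 + - (real k / real n)) ^ m"
    by (rule Bernoulli_inequality) (use kn in \<open>simp add: field_simps\<close>)
  also have "\<dots> = real (n - k) ^ m / real n ^ m"
    using kn n(2) by (simp add: power_divide[symmetric] diff_divide_distrib of_nat_diff)
  finally have b: "1 - x \<le> real (n - k) ^ m / real n ^ m" .
  have "1 \<le> (1 + 2 * x) * (1 - x)"
  proof -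
    have "0 \<le> x * (1 - 2 * x)" using x by (intro mult_nonneg_nonneg) auto
    then show ?thesis by (simp add: algebra_simps)
  qed
  also have "\<dots> \<le> (1 + 2 * x) * (real (n - k) ^ m / real n ^ m)"
    using b x by (intro mult_left_mono) auto
  finally have "1 / real (n - k) ^ m \<le> (1 + 2 * x) / real n ^ m"
    using kn n(2) by (simp add: field_simps)
  then show 1: "1 / real (n - k) ^ m \<le> (1 + 2 * real k ^ 2 / real n) / real n ^ m"
    by (simp add: x_def)
  also have "\<dots> \<le> 2 / real n ^ m"
    using x n(2) by (intro divide_right_mono) (auto simp: x_def)
  finally show "1 / real (n - k) ^ m \<le> 2 / real n ^ m" .
qed

lemma power_diff_ge:
  assumes "k \<le> n" "1 \<le> n"
  shows "real n ^ k * (1 - real k ^ 2 / real n) \<le> real (n - k) ^ k"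
proof -
  have "1 - real k ^ 2 / real n = 1 + real k * (- (real k / real n))"
    by (simp add: power2_eq_square)
  also have "\<dots> \<le> (1 + - (real k / real n)) ^ k"
    by (rule Bernoulli_inequality) (use assms in \<open>simp add: field_simps\<close>)
  also have "\<dots> = real (n - k) ^ k / real n ^ k"
    using assms by (simp add: power_divide[symmetric] diff_divide_distrib of_nat_diff)
  finally show ?thesis using assms by (simp add: field_simps)
qed

section \<open>Expected occurrences and pairs of occurrences\<close>

context folded
begin

lemma constraints_subset:
  assumes "f \<in> placements n H"
  shows "constraints H f \<subseteq> {1..d div 2} \<times> {1..n} \<times> {1..n}"
proof (rule image_subsetI)
  fix a assume a: "a \<in> garcs H"
  have "f (tail (dg H) a) \<in> {1..n}" "f (head (dg H) a) \<in> {1..n}"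
    using assms a by (auto simp: placements_def PiE_iff)
  then show "constraint H f a \<in> {1..d div 2} \<times> {1..n} \<times> {1..n}"
    using lab_in[OF a] by (cases "lab H a") (auto simp: constraint_def pi_labels_def)
qed

lemma card_all_constraints:
  assumes "f \<in> placements n H"
  shows "card (constraints H f) = card (undirected_edges H)"
  using card_constraints[of f "garcs H"] card_arcs assms by (auto simp: placements_def)

lemma constraint_PermE:
  assumes "(j, x, y) \<in> constraints H f"
  obtains a where "a \<in> garcs H" "lab H a = Perm j" "x = f (tail (dg H) a)" "y = f (head (dg H) a)"
proof -
  obtain b where b: "b \<in> garcs H" "constraint H f b = (j, x, y)" using assms by force
  show thesis
  proof (cases "lab H b")
    case Perm
    then show thesis using b that[of b] by (simp add: constraint_def)
  next
    case PermInv
    then show thesis using b that[of "opp H b"] by (simp add: constraint_def lab_opp)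
  qed
qed

text \<open>Edges with equal label and tail coincide; applied to the reverse edges, the same holds
  for heads. This is the consistency required by \<open>prob_satisfies_ge\<close>.\<close>

lemma constraints_partial_injection:
  assumes f: "inj_on f (gverts H)"
    and C: "(j, x, y) \<in> constraints H f" "(j, x', y') \<in> constraints H f"
  shows "x = x' \<longleftrightarrow> y = y'"
proof -
  obtain a where a: "a \<in> garcs H" "lab H a = Perm j" "x = f (tail (dg H) a)" "y = f (head (dg H) a)"
    using C(1) by (rule constraint_PermE)
  obtain b where b: "b \<in> garcs H" "lab H b = Perm j" "x' = f (tail (dg H) b)" "y' = f (head (dg H) b)"
    using C(2) by (rule constraint_PermE)
  have "x = x' \<longleftrightarrow> tail (dg H) a = tail (dg H) b" "y = y' \<longleftrightarrow> head (dg H) a = head (dg H) b"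
    using a b f by (simp_all add: inj_on_eq_iff)
  moreover have "a = b" if "tail (dg H) a = tail (dg H) b"
    using arc_eqI[of a b] a b that by simp
  moreover have "a = b" if "head (dg H) a = head (dg H) b"
    using arc_eqI[of "opp H a" "opp H b"] a b that by (simp add: lab_opp arev_eq_iff)
  ultimately show ?thesis by metis
qed

lemma card_placements_le: "card (placements n H) \<le> n ^ card (gverts H)"
proof -
  have "card (placements n H) \<le> card (gverts H \<rightarrow>\<^sub>E {1..n})"
    unfolding placements_def by (rule card_mono) (auto intro: finite_PiE finite_verts)
  then show ?thesis by (simp add: card_PiE finite_verts)
qed

lemma card_placements_ge: "(n - card (gverts H)) ^ card (gverts H) \<le> card (placements n H)"
  using card_inj_funcset_ge[OF finite_verts, of "{1..n}" "card (gverts H)"]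
  by (simp add: placements_def)

lemma expectation_occurrences:
  "measure_pmf.expectation (random_graph n d) (\<lambda>G. real (card (occurrences H G))) =
   measure_pmf.expectation (random_perms n d) (\<lambda>p. real (card (occ_maps n p H)))"
  unfolding random_graph_random_perms integral_map_pmf
proof (rule integral_cong_AE)
  show "AE p in measure_pmf (random_perms n d).
      real (card (occurrences H (perm_graph n d p))) = real (card (occ_maps n p H))"
    unfolding AE_measure_pmf_iff
  proof
    fix p assume "p \<in> set_pmf (random_perms n d)"
    then have "p j permutes {1..n}" for j by (rule permutes_random_perms)
    from card_occurrences_perm_graph[of p n, OF this]
    show "real (card (occurrences H (perm_graph n d p))) = real (card (occ_maps n p H))" by simp
  qed
qed auto

lemma expectation_occ_maps:
  "measure_pmf.expectation (random_perms n d) (\<lambda>p. real (card (occ_maps n p H))) =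
   (\<Sum>f\<in>placements n H. measure_pmf.prob (random_perms n d) {p. satisfies p (constraints H f)})"
  unfolding occ_maps_def
  by (rule expectation_card) (auto simp: finite_placements finite_verts finite_set_random_perms)

text \<open>With \<open>v\<close> vertices and \<open>e = v + r\<close> undirected edges there are
  about \<open>n ^ v\<close> placements, each an occurrence with probability about
  \<open>1 / n ^ e\<close>.\<close>

lemma expectation_bound:
  assumes r: "card (undirected_edges H) = card (gverts H) + r"
  shows "\<exists>K N. \<forall>n\<ge>N. \<bar>measure_pmf.expectation (random_perms n d) (\<lambda>p. real (card (occ_maps n p H)))
     - 1 / real n ^ r\<bar> \<le> K / real n ^ (r + 1)"
proof -
  define e where "e = card (undirected_edges H)"
  define v where "v = card (gverts H)"
  have ev: "e = v + r" using r by (simp add: e_def v_def)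
  \<comment> \<open>The term \<open>2 * e\<^sup>2\<close> comes from the upper bound on the
    probabilities and \<open>v\<^sup>2\<close> from the lower bound on the number of placements. The
    threshold on \<open>n\<close> ensures \<open>e < n\<close> and the hypothesis of
    \<open>inverse_power_le\<close>.\<close>
  have "\<bar>measure_pmf.expectation (random_perms n d) (\<lambda>p. real (card (occ_maps n p H)))
     - 1 / real n ^ r\<bar> \<le> (2 * real e ^ 2 + real v ^ 2) / real n ^ (r + 1)"
    if n: "2 * e\<^sup>2 + e + 1 \<le> n" for n
  proof -
    let ?pr = "\<lambda>f. measure_pmf.prob (random_perms n d) {p. satisfies p (constraints H f)}"
    let ?E = "\<Sum>f\<in>placements n H. ?pr f"
    have n1: "real n > 0" "e < n" "v \<le> n" using n ev by auto
    have "?E \<le> (\<Sum>f\<in>placements n H. (1 + 2 * real e ^ 2 / real n) / real n ^ e)"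
    proof (rule sum_mono)
      fix f assume f: "f \<in> placements n H"
      have "?pr f \<le> 1 / real (n - e) ^ e"
        using prob_satisfies_le[OF constraints_subset[OF f], of e] n1
        by (simp add: card_all_constraints[OF f] e_def)
      also have "\<dots> \<le> (1 + 2 * real e ^ 2 / real n) / real n ^ e"
        by (rule inverse_power_le(1)) (use n in auto)
      finally show "?pr f \<le> (1 + 2 * real e ^ 2 / real n) / real n ^ e" .
    qed
    also have "\<dots> = real (card (placements n H)) * ((1 + 2 * real e ^ 2 / real n) / real n ^ e)"
      by simp
    also have "\<dots> \<le> real (n ^ v) * ((1 + 2 * real e ^ 2 / real n) / real n ^ e)"
      using card_placements_le[of n] by (intro mult_right_mono) (auto simp: v_def)
    also have "\<dots> = 1 / real n ^ r + 2 * real e ^ 2 / real n ^ (r + 1)"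
      using n1 by (simp add: ev power_add field_simps)
    finally have up: "?E \<le> 1 / real n ^ r + 2 * real e ^ 2 / real n ^ (r + 1)" .
    have "1 / real n ^ r - real v ^ 2 / real n ^ (r + 1) =
        real n ^ v * (1 - real v ^ 2 / real n) * (1 / real n ^ e)"
      using n1 by (simp add: ev power_add field_simps)
    also have "\<dots> \<le> real (n - v) ^ v * (1 / real n ^ e)"
      by (intro mult_right_mono power_diff_ge) (use n1 in auto)
    also have "\<dots> \<le> real (card (placements n H)) * (1 / real n ^ e)"
      using card_placements_ge[of n] by (intro mult_right_mono) (auto simp: v_def simp flip: of_nat_power)
    also have "\<dots> = (\<Sum>f\<in>placements n H. 1 / real n ^ e)" by simp
    also have "\<dots> \<le> ?E"
    proof (rule sum_mono)
      fix f assume f: "f \<in> placements n H"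
      have "inj_on f (gverts H)" using f by (simp add: placements_def)
      from prob_satisfies_ge[OF constraints_subset[OF f] _ constraints_partial_injection[OF this]]
      show "1 / real n ^ e \<le> ?pr f"
        using n1 by (simp add: card_all_constraints[OF f] e_def)
    qed
    finally have "1 / real n ^ r - real v ^ 2 / real n ^ (r + 1) \<le> ?E" .
    moreover have "0 \<le> real v ^ 2 / real n ^ (r + 1)" "0 \<le> 2 * real e ^ 2 / real n ^ (r + 1)" by auto
    ultimately show ?thesis
      using up unfolding expectation_occ_maps add_divide_distrib abs_le_iff by linarith
  qed
  then show ?thesis by blast
qed

end

section \<open>Distinct images and the second moment\<close>

definition shadow :: "('v, 'e) pi_graph \<Rightarrow> ('v \<Rightarrow> nat) \<Rightarrow> nat set \<times> (nat \<times> nat \<times> nat) set" where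
  "shadow H f = (f ` gverts H, constraints H f)"

text \<open>The shadow encodes the image subgraph by its vertices and labelled edges, so different
  shadows mean different copies of \<open>H\<close>, not merely different maps.\<close>

definition distinct_pairs :: "nat \<Rightarrow> ('v, 'e) pi_graph \<Rightarrow> (('v \<Rightarrow> nat) \<times> ('v \<Rightarrow> nat)) set" where
  "distinct_pairs n H = {(f, g) \<in> placements n H \<times> placements n H. shadow H f \<noteq> shadow H g}"

text \<open>Coincidences are recorded on the vertices of \<open>H\<close> rather than on their
  images, so that the number of possible overlaps does not grow with \<open>n\<close>.\<close>

definition overlap :: "('v, 'e) pi_graph \<Rightarrow> ('v \<Rightarrow> nat) \<Rightarrow> ('v \<Rightarrow> nat) \<Rightarrow> ('v \<times> 'v) set" where
  "overlap H f g = {(x, y) \<in> gverts H \<times> gverts H. f x = g y}"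

definition occ_pairs :: "nat \<Rightarrow> (nat \<Rightarrow> nat \<Rightarrow> nat) \<Rightarrow> ('v, 'e) pi_graph \<Rightarrow> (('v \<Rightarrow> nat) \<times> ('v \<Rightarrow> nat)) set" where
  "occ_pairs n p H =
     {z \<in> distinct_pairs n H. satisfies p (constraints H (fst z) \<union> constraints H (snd z))}"

context folded
begin

text \<open>The shadow is constant on classes of exactly \<open>c\<close> occurrences. Hence
  \<open>N\<close> is the number of distinct images, and \<open>c * Y\<close> ordered pairs of
  occurrences share their image.\<close>

lemma occ_maps_pairs:
  fixes p n
  defines "c \<equiv> card (automorphisms H)" and "Y \<equiv> card (occ_maps n p H)"
  obtains N where "Y = c * N" "card (occ_pairs n p H) + c * Y = Y * Y"
proof -
  let ?O = "occ_maps n p H"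
  have finO: "finite ?O" by (simp add: finite_occ_maps finite_verts)
  have fiber: "card {g \<in> ?O. shadow H g = shadow H f} = c" if f: "f \<in> ?O" for f
  proof -
    \<comment> \<open>A placement with the same shadow makes the same prescriptions, so it is
      automatically an occurrence.\<close>
    have "{g \<in> ?O. shadow H g = shadow H f} =
      {g \<in> placements n H. g ` gverts H = f ` gverts H \<and> constraints H g = constraints H f}"
      using f by (auto simp: occ_maps_def shadow_def)
    then show ?thesis using card_same_image[of f n] f by (simp add: c_def occ_maps_def)
  qed
  have "Y = (\<Sum>y\<in>shadow H ` ?O. card {g \<in> ?O. shadow H g = y})"
    unfolding Y_def using sum.image_gen[OF finO, of "\<lambda>_. 1::nat" "shadow H"] by simp
  also have "\<dots> = (\<Sum>y\<in>shadow H ` ?O. c)"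
    by (rule sum.cong) (use fiber in auto)
  finally have 1: "Y = c * card (shadow H ` ?O)" by simp
  let ?S = "Sigma ?O (\<lambda>f. {g \<in> ?O. shadow H g = shadow H f})"
  have Un: "occ_pairs n p H \<union> ?S = ?O \<times> ?O"
    by (auto simp: occ_pairs_def distinct_pairs_def occ_maps_def satisfies_Un)
  have disj: "occ_pairs n p H \<inter> ?S = {}"
    by (auto simp: occ_pairs_def distinct_pairs_def)
  have "finite (occ_pairs n p H \<union> ?S)" unfolding Un using finO by simp
  then have "card (occ_pairs n p H) + card ?S = card (?O \<times> ?O)"
    unfolding Un[symmetric] by (intro card_Un_disjoint[OF _ _ disj, symmetric]) simp_all
  moreover have "card ?S = c * Y"
    using finO fiber by (subst card_SigmaI) (auto simp: Y_def)
  ultimately have "card (occ_pairs n p H) + c * Y = Y * Y"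
    by (simp add: Y_def card_cartesian_product)
  then show thesis using that 1 by blast
qed

text \<open>
  Bonferroni's inequality for the \<open>N\<close> distinct images, each of which is counted \<open>c\<close> times in
  \<open>Y\<close> and each ordered pair of which is counted \<open>c\<^sup>2\<close> times in \<open>occ_pairs\<close>.
\<close>
lemma bonferroni_occ:
  fixes p n
  defines "c \<equiv> real (card (automorphisms H))"
  shows "real (card (occ_maps n p H)) / c - real (card (occ_pairs n p H)) / (2 * c ^ 2)
    \<le> (if occ_maps n p H = {} then 0 else 1)"
proof -
  obtain N where N: "card (occ_maps n p H) = card (automorphisms H) * N"
    "card (occ_pairs n p H) + card (automorphisms H) * card (occ_maps n p H)
      = card (occ_maps n p H) * card (occ_maps n p H)"
    by (rule occ_maps_pairs)
  show ?thesis
  proof (cases "card (occ_maps n p H) = 0")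
    case True
    then have "card (occ_pairs n p H) = 0" "occ_maps n p H = {}"
      using N(2) finite_occ_maps[OF finite_verts] by auto
    then show ?thesis by simp
  next
    case False
    have c: "c > 0" and N1: "N \<ge> 1" and ne: "occ_maps n p H \<noteq> {}"
      using False N(1) by (auto simp: c_def)
    have Y: "real (card (occ_maps n p H)) = c * real N"
      using N(1) by (simp add: c_def)
    have "real (card (occ_pairs n p H)) + c * real (card (occ_maps n p H))
        = real (card (occ_maps n p H)) * real (card (occ_maps n p H))"
      using arg_cong[OF N(2), of real] by (simp add: c_def)
    then have Z: "real (card (occ_pairs n p H)) = c ^ 2 * (real N * (real N - 1))"
      unfolding Y by (simp add: power2_eq_square algebra_simps)
    \<comment> \<open>No integer lies strictly between 1 and 2. Expanded, this is Bonferroni's bound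
      for \<open>N\<close> events that all hold.\<close>
    have "0 \<le> (real N - 1) * (real N - 2)"
      using N1 by (cases "N = 1") (auto intro!: mult_nonneg_nonneg)
    then have "real N - real N * (real N - 1) / 2 \<le> 1" by (simp add: field_simps)
    then show ?thesis unfolding Y Z using c ne by simp
  qed
qed

lemma card_overlap:
  assumes f: "f \<in> placements n H" and g: "g \<in> placements n H"
  shows "card (overlap H f g) = card {x \<in> gverts H. f x \<in> g ` gverts H}"
    and "card (overlap H f g) = card (snd ` overlap H f g)"
proof -
  have inj: "inj_on f (gverts H)" "inj_on g (gverts H)" using f g by (auto simp: placements_def)
  have "inj_on fst (overlap H f g)" "inj_on snd (overlap H f g)"
    using inj by (auto simp: overlap_def inj_on_def)
  moreover have "fst ` overlap H f g = {x \<in> gverts H. f x \<in> g ` gverts H}"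
    by (force simp: overlap_def)
  ultimately show "card (overlap H f g) = card {x \<in> gverts H. f x \<in> g ` gverts H}"
    and "card (overlap H f g) = card (snd ` overlap H f g)"
    by (metis card_image)+
qed

text \<open>The common part of the two images corresponds to a proper nonempty subgraph
  \<open>(V1, A1)\<close> of \<open>H\<close>, which has order less than \<open>r\<close>. By
  inclusion and exclusion the union has order at least
  \<open>2 * r - (r - 1) = r + 1\<close>.\<close>

lemma union_constraints_ge:
  assumes "conn H" and leaf: "\<And>v. \<not> is_leaf H v"
    and r: "card (undirected_edges H) = card (gverts H) + r"
    and z: "(f, g) \<in> distinct_pairs n H" and ov: "overlap H f g \<noteq> {}"
  shows "2 * card (undirected_edges H) + 1 \<le>
     card (constraints H f \<union> constraints H g) + r + card (overlap H f g)"
proof -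
  have f: "f \<in> placements n H" and g: "g \<in> placements n H" and ne: "shadow H f \<noteq> shadow H g"
    using z by (auto simp: distinct_pairs_def)
  have inj: "inj_on f (gverts H)" "inj_on g (gverts H)" using f g by (auto simp: placements_def)
  define V1 where "V1 = {x \<in> gverts H. f x \<in> g ` gverts H}"
  define A1 where "A1 = {a \<in> garcs H. constraint H f a \<in> constraints H g}"
  have fin: "finite (constraints H f)" "finite (constraints H g)" using finite_arcs by auto
  have "tail (dg H) a \<in> V1 \<and> head (dg H) a \<in> V1" if a: "a \<in> A1" for a
  proof -
    obtain b where b: "b \<in> garcs H" "constraint H g b = constraint H f a"
      using a by (auto simp: A1_def)
    obtain b' where "b' \<in> garcs H" "g (tail (dg H) b') = f (tail (dg H) a)"
        "g (head (dg H) b') = f (head (dg H) a)"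
      using constraint_eqE[OF b] by blast
    then have "f (tail (dg H) a) \<in> g ` gverts H" "f (head (dg H) a) \<in> g ` gverts H"
      by (metis imageI tail_in_verts, metis imageI head_in_verts)
    then show ?thesis using a by (auto simp: V1_def A1_def)
  qed
  \<comment> \<open>Otherwise the image of \<open>f\<close> would be contained in that of
    \<open>g\<close>, and equal cardinalities would make the shadows equal.\<close>
  moreover have "V1 \<noteq> gverts H \<or> A1 \<noteq> garcs H"
  proof (rule ccontr)
    assume "\<not> ?thesis"
    then have "f ` gverts H \<subseteq> g ` gverts H" "constraints H f \<subseteq> constraints H g"
      unfolding V1_def A1_def by blast+
    moreover have "card (f ` gverts H) = card (g ` gverts H)" using inj by (simp add: card_image)
    moreover have "card (constraints H f) = card (constraints H g)"
      using card_all_constraints[OF f] card_all_constraints[OF g] by simp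
    ultimately have "shadow H f = shadow H g"
      unfolding shadow_def using fin finite_verts by (simp add: card_subset_eq)
    then show False using ne by simp
  qed
  moreover have "V1 \<noteq> {}" using ov by (auto simp: overlap_def V1_def)
  ultimately have less: "card A1 + 2 * card (gverts H) < card (garcs H) + 2 * card V1"
    by (intro order_subgraph_less[OF assms(1) leaf]) (auto simp: V1_def A1_def)
  have "card A1 = 2 * card (constraint H f ` A1)"
    by (rule card_constraints[OF inj(1)]) (auto simp: A1_def constraint_opp)
  moreover have "constraint H f ` A1 = constraints H f \<inter> constraints H g"
    unfolding A1_def by blast
  ultimately have "card (constraints H f \<inter> constraints H g) < r + card V1"
    using less r card_arcs by simp
  moreover have "card (constraints H f) + card (constraints H g) =
      card (constraints H f \<union> constraints H g) + card (constraints H f \<inter> constraints H g)"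
    by (rule card_Un_Int[OF fin])
  ultimately show ?thesis
    using card_overlap(1)[OF f g] card_all_constraints[OF f] card_all_constraints[OF g]
    by (simp add: V1_def)
qed

lemma disjoint_constraints:
  assumes "overlap H f g = {}"
  shows "constraints H f \<inter> constraints H g = {}"
proof (rule ccontr)
  assume "\<not> ?thesis"
  then obtain a b where ab: "a \<in> garcs H" "b \<in> garcs H" "constraint H g b = constraint H f a" by auto
  obtain b' where b': "b' \<in> garcs H" "g (tail (dg H) b') = f (tail (dg H) a)"
    using constraint_eqE[OF ab(2,3)] by blast
  then have "(tail (dg H) a, tail (dg H) b') \<in> overlap H f g"
    using ab by (simp add: overlap_def)
  then show False using assms by simp
qed

text \<open>
  On the second projection of the overlap the second placement is determined by the first.
\<close>
lemma card_pairs_overlap_le: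
  "card {z \<in> distinct_pairs n H. overlap H (fst z) (snd z) = R} \<le> n ^ (2 * card (gverts H) - card R)"
proof (cases "{z \<in> distinct_pairs n H. overlap H (fst z) (snd z) = R} = {}")
  case False
  let ?Z = "{z \<in> distinct_pairs n H. overlap H (fst z) (snd z) = R}"
  let ?V = "gverts H" and ?W = "gverts H - snd ` R"
  from False obtain f0 g0 where 0: "f0 \<in> placements n H" "g0 \<in> placements n H" "R = overlap H f0 g0"
    by (auto simp: distinct_pairs_def)
  have RV: "R \<subseteq> ?V \<times> ?V" using 0 by (auto simp: overlap_def)
  have "card ?Z \<le> card ((?V \<rightarrow>\<^sub>E {1..n}) \<times> (?W \<rightarrow>\<^sub>E {1..n}))"
  proof (rule card_inj_on_le[where f = "\<lambda>(f, g). (f, restrict g ?W)"])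
    show "inj_on (\<lambda>(f, g). (f, restrict g ?W)) ?Z"
    proof (rule inj_onI, clarsimp)
      fix f g g' assume z: "(f, g) \<in> distinct_pairs n H" "(f, g') \<in> distinct_pairs n H"
        and R: "R = overlap H f g" "overlap H f g' = overlap H f g"
        and eq: "restrict g (?V - snd ` overlap H f g) = restrict g' (?V - snd ` overlap H f g)"
      have "g y = g' y" if y: "y \<in> ?V" for y
      proof (cases "y \<in> snd ` overlap H f g")
        case True
        then obtain x where x: "(x, y) \<in> overlap H f g" by auto
        then have "(x, y) \<in> overlap H f g'" using R by simp
        then show ?thesis using x by (simp add: overlap_def)
      next
        case False
        then show ?thesis using fun_cong[OF eq, of y] y by simp
      qed
      then show "g = g'"
        using z by (intro PiE_ext[of g ?V "\<lambda>_. {1..n}"]) (auto simp: distinct_pairs_def placements_def)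
    qed
    show "(\<lambda>(f, g). (f, restrict g ?W)) ` ?Z \<subseteq> (?V \<rightarrow>\<^sub>E {1..n}) \<times> (?W \<rightarrow>\<^sub>E {1..n})"
    proof (rule image_subsetI)
      fix z assume "z \<in> ?Z"
      then obtain f g where z: "z = (f, g)" "f \<in> placements n H" "g \<in> placements n H"
        unfolding distinct_pairs_def by blast
      have "f \<in> ?V \<rightarrow>\<^sub>E {1..n}" "restrict g ?W \<in> ?W \<rightarrow>\<^sub>E {1..n}"
        using z unfolding placements_def PiE_iff by auto
      then show "(\<lambda>(f, g). (f, restrict g ?W)) z \<in> (?V \<rightarrow>\<^sub>E {1..n}) \<times> (?W \<rightarrow>\<^sub>E {1..n})"
        by (simp add: z)
    qed
    show "finite ((?V \<rightarrow>\<^sub>E {1..n}) \<times> (?W \<rightarrow>\<^sub>E {1..n}))"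
      by (intro finite_cartesian_product finite_PiE) (use finite_verts in auto)
  qed
  also have "\<dots> = n ^ (card ?V + card ?W)"
    using finite_verts by (simp add: card_cartesian_product card_PiE power_add)
  also have "card ?W = card ?V - card R"
  proof -
    have "snd ` R \<subseteq> ?V" using RV by auto
    then show ?thesis
      using card_overlap(2)[OF 0(1,2)] 0(3) finite_verts
      by (simp add: card_Diff_subset finite_subset)
  qed
  also have "card ?V + (card ?V - card R) = 2 * card ?V - card R"
  proof -
    have "card R \<le> card ?V"
      unfolding 0(3) card_overlap(1)[OF 0(1,2)] by (rule card_mono) (use finite_verts in auto)
    then show ?thesis by simp
  qed
  finally show ?thesis .
next
  case True
  show ?thesis unfolding True by simp
qed

lemma finite_distinct_pairs: "finite (distinct_pairs n H)"
  by (rule finite_subset[of _ "placements n H \<times> placements n H"])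
    (auto simp: distinct_pairs_def finite_placements finite_verts)

text \<open>At most \<open>n ^ (2 * v)\<close> pairs are disjoint, each with \<open>2 * e\<close>
  prescriptions; they give the main term. For each nonempty overlap \<open>R\<close> there are at
  most \<open>n ^ (2 * v - card R)\<close> pairs with at least \<open>2 * v - card R + r + 1\<close>
  prescriptions, which contributes only to the error.\<close>

lemma expectation_pairs_bound:
  assumes "conn H" and leaf: "\<And>v. \<not> is_leaf H v"
    and r: "card (undirected_edges H) = card (gverts H) + r"
  shows "\<exists>K N. \<forall>n\<ge>N. measure_pmf.expectation (random_perms n d) (\<lambda>p. real (card (occ_pairs n p H)))
     \<le> 1 / real n ^ (2 * r) + K / real n ^ (r + 1)"
proof -
  define e where "e = card (undirected_edges H)"
  define v where "v = card (gverts H)"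
  define RR where "RR = Pow (gverts H \<times> gverts H)"
  have ev: "e = v + r" using r by (simp add: e_def v_def)
  \<comment> \<open>The first summand is the relative error \<open>2 * (2 * e)\<^sup>2\<close> of
    the disjoint pairs; the second allows 2 for each relation in \<open>RR\<close>.\<close>
  define K where "K = 8 * real e ^ 2 + 2 * real (card RR)"
  have "measure_pmf.expectation (random_perms n d) (\<lambda>p. real (card (occ_pairs n p H)))
     \<le> 1 / real n ^ (2 * r) + K / real n ^ (r + 1)" if n: "2 * (2 * e)\<^sup>2 + 2 * e + 1 \<le> n" for n
  proof -
    define pr where "pr z = measure_pmf.prob (random_perms n d)
      {p. satisfies p (constraints H (fst z) \<union> constraints H (snd z))}" for z
    define Zd where "Zd = {z \<in> distinct_pairs n H. overlap H (fst z) (snd z) = {}}"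
    define Zo where "Zo = {z \<in> distinct_pairs n H. overlap H (fst z) (snd z) \<noteq> {}}"
    have n1: "real n \<ge> 1" "2 * e < n" using n by auto
    have n2: "2 * (2 * e)\<^sup>2 \<le> n" "1 \<le> n" using n by auto
    have prle: "pr (f, g) \<le> 1 / real (n - 2 * e) ^ card (constraints H f \<union> constraints H g)
        \<and> card (constraints H f \<union> constraints H g) \<le> 2 * e"
      if z: "(f, g) \<in> distinct_pairs n H" for f g
    proof -
      have fg: "f \<in> placements n H" "g \<in> placements n H" using z by (auto simp: distinct_pairs_def)
      have "card (constraints H f \<union> constraints H g) \<le> 2 * e"
        using card_Un_le[of "constraints H f" "constraints H g"]
        by (simp add: card_all_constraints[OF fg(1)] card_all_constraints[OF fg(2)] e_def)
      moreover from this have "pr (f, g) \<le> 1 / real (n - 2 * e) ^ card (constraints H f \<union> constraints H g)"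
        unfolding pr_def fst_conv snd_conv
        by (intro prob_satisfies_le) (use fg constraints_subset n1 in auto)
      ultimately show ?thesis by simp
    qed
    have "(\<Sum>z\<in>Zd. pr z) \<le> (\<Sum>z\<in>Zd. (1 + 2 * real (2 * e) ^ 2 / real n) / real n ^ (2 * e))"
    proof (rule sum_mono)
      fix z assume z: "z \<in> Zd"
      obtain f g where fg: "z = (f, g)" by (cases z)
      have z': "(f, g) \<in> distinct_pairs n H" "overlap H f g = {}" using z by (auto simp: fg Zd_def)
      then have pl: "f \<in> placements n H" "g \<in> placements n H" by (auto simp: distinct_pairs_def)
      have "card (constraints H f \<union> constraints H g) = 2 * e"
        using disjoint_constraints[OF z'(2)] finite_arcs
        by (simp add: card_Un_disjoint card_all_constraints[OF pl(1)] card_all_constraints[OF pl(2)] e_def)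
      then have "pr z \<le> 1 / real (n - 2 * e) ^ (2 * e)" using prle[OF z'(1)] fg by simp
      also have "\<dots> \<le> (1 + 2 * real (2 * e) ^ 2 / real n) / real n ^ (2 * e)"
        by (rule inverse_power_le(1)[OF n2]) simp
      finally show "pr z \<le> (1 + 2 * real (2 * e) ^ 2 / real n) / real n ^ (2 * e)" .
    qed
    also have "\<dots> = real (card Zd) * ((1 + 2 * real (2 * e) ^ 2 / real n) / real n ^ (2 * e))" by simp
    also have "\<dots> \<le> real (n ^ (2 * v)) * ((1 + 2 * real (2 * e) ^ 2 / real n) / real n ^ (2 * e))"
      using card_pairs_overlap_le[of n "{}"] by (intro mult_right_mono) (auto simp: Zd_def v_def)
    also have "\<dots> = 1 / real n ^ (2 * r) + 8 * real e ^ 2 / real n ^ (2 * r + 1)"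
    proof -
      have 1: "2 * real (2 * e) ^ 2 = 8 * real e ^ 2" by (simp add: power2_eq_square)
      have 2: "real n ^ (2 * e) = real n ^ (2 * v) * real n ^ (2 * r)"
        by (simp add: ev distrib_left power_add)
      show ?thesis unfolding 1 2 using n1 by (simp add: field_simps)
    qed
    \<comment> \<open>The error of the disjoint pairs is weakened to the order \<open>r + 1\<close>
      of the overlapping ones.\<close>
    also have "\<dots> \<le> 1 / real n ^ (2 * r) + 8 * real e ^ 2 / real n ^ (r + 1)"
      using n1 by (intro add_left_mono divide_left_mono power_increasing) auto
    finally have d: "(\<Sum>z\<in>Zd. pr z) \<le> 1 / real n ^ (2 * r) + 8 * real e ^ 2 / real n ^ (r + 1)" .
    have "(\<Sum>z\<in>Zo. pr z) = (\<Sum>R\<in>RR. \<Sum>z\<in>{z \<in> Zo. overlap H (fst z) (snd z) = R}. pr z)"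
      by (rule sum.group[symmetric])
        (auto simp: Zo_def finite_distinct_pairs finite_verts RR_def overlap_def)
    also have "\<dots> \<le> (\<Sum>R\<in>RR. 2 / real n ^ (r + 1))"
    proof (rule sum_mono)
      fix R
      let ?Z = "{z \<in> Zo. overlap H (fst z) (snd z) = R}"
      show "(\<Sum>z\<in>?Z. pr z) \<le> 2 / real n ^ (r + 1)"
      proof (cases "?Z = {}")
        case True
        show ?thesis unfolding True by simp
      next
        case False
        have key: "pr z \<le> 2 / real n ^ (2 * v + r + 1 - card R) \<and> card R \<le> v" if z: "z \<in> ?Z" for z
        proof -
          obtain f g where fg: "z = (f, g)" by (cases z)
          have z': "(f, g) \<in> distinct_pairs n H" "overlap H f g \<noteq> {}" "overlap H f g = R"
            using z by (auto simp: fg Zo_def)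
          then have pl: "f \<in> placements n H" "g \<in> placements n H" by (auto simp: distinct_pairs_def)
          have Rv: "card R \<le> v"
            unfolding z'(3)[symmetric] card_overlap(1)[OF pl] v_def
            by (rule card_mono) (use finite_verts in auto)
          let ?m = "card (constraints H f \<union> constraints H g)"
          have "2 * v + r + 1 - card R \<le> ?m"
            using union_constraints_ge[OF assms(1) leaf r z'(1,2)] z'(3) ev by (simp add: e_def)
          have "pr z \<le> 1 / real (n - 2 * e) ^ ?m" using prle[OF z'(1)] fg by simp
          also have "\<dots> \<le> 2 / real n ^ ?m"
            by (rule inverse_power_le(2)[OF n2]) (use prle[OF z'(1)] in simp)
          also have "\<dots> \<le> 2 / real n ^ (2 * v + r + 1 - card R)"
            using n1 \<open>_ \<le> ?m\<close> by (intro divide_left_mono power_increasing) auto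
          finally show ?thesis using Rv by simp
        qed
        have "card R \<le> v" using False key by blast
        have "(\<Sum>z\<in>?Z. pr z) \<le> (\<Sum>z\<in>?Z. 2 / real n ^ (2 * v + r + 1 - card R))"
          by (rule sum_mono) (use key in blast)
        also have "\<dots> = real (card ?Z) * (2 / real n ^ (2 * v + r + 1 - card R))" by simp
        also have "\<dots> \<le> real (n ^ (2 * v - card R)) * (2 / real n ^ (2 * v + r + 1 - card R))"
        proof -
          have "card ?Z \<le> card {z \<in> distinct_pairs n H. overlap H (fst z) (snd z) = R}"
            by (rule card_mono) (auto simp: finite_distinct_pairs Zo_def)
          also have "\<dots> \<le> n ^ (2 * v - card R)" unfolding v_def by (rule card_pairs_overlap_le)
          finally show ?thesis by (intro mult_right_mono) auto
        qed
        also have "2 * v + r + 1 - card R = (2 * v - card R) + (r + 1)"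
          using \<open>card R \<le> v\<close> by simp
        also have "real (n ^ (2 * v - card R)) * (2 / real n ^ ((2 * v - card R) + (r + 1)))
            = 2 / real n ^ (r + 1)"
          using n1 by (simp add: power_add)
        finally show ?thesis .
      qed
    qed
    also have "\<dots> = 2 * real (card RR) / real n ^ (r + 1)" by simp
    finally have o: "(\<Sum>z\<in>Zo. pr z) \<le> 2 * real (card RR) / real n ^ (r + 1)" .
    have "measure_pmf.expectation (random_perms n d) (\<lambda>p. real (card (occ_pairs n p H)))
      = (\<Sum>z\<in>distinct_pairs n H. pr z)"
      unfolding occ_pairs_def pr_def
      by (rule expectation_card) (auto simp: finite_distinct_pairs finite_set_random_perms)
    also have "distinct_pairs n H = Zd \<union> Zo" by (auto simp: Zd_def Zo_def)
    also have "(\<Sum>z\<in>Zd \<union> Zo. pr z) = (\<Sum>z\<in>Zd. pr z) + (\<Sum>z\<in>Zo. pr z)"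
      by (rule sum.union_disjoint) (auto simp: Zd_def Zo_def finite_distinct_pairs)
    finally show ?thesis using d o by (simp add: K_def add_divide_distrib)
  qed
  then show ?thesis by blast
qed

end

section \<open>Tangles and the two asymptotic statements\<close>

lemma folded_tangle:
  assumes "tangle d T"
  shows "folded T d"
proof -
  have lab: "pi_labelled d T" using assms by (simp add: tangle_def)
  then interpret bidirected_digraph "dg T" "opp T" by (simp add: pi_labelled_def)
  obtain n G f g where G: "G \<in> set_pmf (random_graph n d)" and fg: "(f, g) \<in> occurrences T G"
    using assms by (auto simp: tangle_def occurs_in_def)
  obtain p where p: "G = perm_graph n d p" "\<And>j. p j permutes {1..n}"
    using G permutes_random_perms by (auto simp: random_graph_random_perms)
  have fin: "finite (gverts G)" "finite (garcs G)"
    by (auto simp: p(1) perm_graph_def pi_labels_def)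
  have fg': "f \<in> gverts T \<rightarrow> gverts G" "g \<in> garcs T \<rightarrow> garcs G" "inj_on f (gverts T)" "inj_on g (garcs T)"
    and hom: "\<And>a. a \<in> garcs T \<Longrightarrow> tail (dg G) (g a) = f (tail (dg T) a) \<and> lab G (g a) = lab T a"
    using fg by (auto simp: occurrences_def pi_homs_def)
  show ?thesis
  proof
    show "finite (gverts T)" using fg' fin by (metis inj_on_finite image_subset_iff_funcset)
    show "finite (garcs T)" using fg' fin by (metis inj_on_finite image_subset_iff_funcset)
    \<comment> \<open>In a permutation graph a label and a tail determine the edge; the injective
      edge map carries this property back to \<open>T\<close>.\<close>
    fix a b assume ab: "a \<in> garcs T" "b \<in> garcs T" "lab T a = lab T b" "tail (dg T) a = tail (dg T) b"
    have "tail (dg G) (g a) = tail (dg G) (g b)" "lab G (g a) = lab G (g b)"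
      using hom[OF ab(1)] hom[OF ab(2)] ab(3,4) by simp_all
    then have "g a = g b"
      using permutes_inj[OF p(2)]
      by (cases "g a"; cases "g b") (auto simp: p(1) perm_graph_def split: pi_label.splits dest: injD)
    then show "a = b" using fg'(4) ab by (auto dest: inj_onD)
  qed (use lab in \<open>auto simp: pi_labelled_def\<close>)
qed

theorem theorem4p7:
  fixes d r :: nat and T :: "('v, 'e) pi_graph"
  assumes "even d" and "d \<ge> 4"
    and "tangle d T" and "graph_order T = int r"
  shows "(\<lambda>n. measure_pmf.expectation (random_graph n d) (\<lambda>G. real (card (occurrences T G)))
            - 1 / real n ^ r) \<in> O(\<lambda>n. 1 / real n ^ (r + 1))
       \<and> (\<forall>P c. complete_pruning T P \<longrightarrow> c = card (automorphisms P) \<longrightarrow>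
            (\<exists>h \<in> O(\<lambda>n. 1 / real n ^ (r + 1)). \<forall>n \<ge> 1.
               measure_pmf.prob (random_graph n d) {G. occurs_in T G}
                 \<ge> (1 / real n ^ r) / real c - (1 / real n ^ (2 * r)) / (2 * real c ^ 2) + h n))"
proof (intro conjI allI impI)
  interpret T: folded T d by (rule folded_tangle) fact
  have conn: "conn T" using assms(3) by (intro T.conn_if_connected) (simp add: tangle_def)
  have rT: "card (undirected_edges T) = card (gverts T) + r"
    using assms(4) by (simp add: graph_order_def)
  define eT where "eT n = measure_pmf.expectation (random_perms n d) (\<lambda>p. real (card (occ_maps n p T)))" for n
  obtain K1 N1 where b1: "\<And>n. n \<ge> N1 \<Longrightarrow> \<bar>eT n - 1 / real n ^ r\<bar> \<le> K1 / real n ^ (r + 1)"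
    using T.expectation_bound[OF rT] unfolding eT_def by blast
  show "(\<lambda>n. measure_pmf.expectation (random_graph n d) (\<lambda>G. real (card (occurrences T G)))
            - 1 / real n ^ r) \<in> O(\<lambda>n. 1 / real n ^ (r + 1))"
    unfolding T.expectation_occurrences eT_def[symmetric]
    by (rule bigoI[where c = K1])
      (use b1 in \<open>auto simp: eventually_at_top_linorder intro!: exI[of _ N1]\<close>)
  fix P c assume P: "complete_pruning T P" and c: "c = card (automorphisms P)"
  have steps: "prune_step\<^sup>*\<^sup>* T P" and leaf: "\<And>v. \<not> is_leaf P v"
    using P by (auto simp: complete_pruning_def)
  note pr = pruning_preserves[OF steps T.folded_axioms conn]
  interpret P: folded P d using pr by blast
  have connP: "conn P" and sub: "subgraph_of P T" using pr by auto
  have rP: "card (undirected_edges P) = card (gverts P) + r"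
    using pr rT T.card_arcs P.card_arcs by simp
  define eP where "eP n = measure_pmf.expectation (random_perms n d) (\<lambda>p. real (card (occ_maps n p P)))" for n
  define eZ where "eZ n = measure_pmf.expectation (random_perms n d) (\<lambda>p. real (card (occ_pairs n p P)))" for n
  obtain K2 N2 where b2: "\<And>n. n \<ge> N2 \<Longrightarrow> \<bar>eP n - 1 / real n ^ r\<bar> \<le> K2 / real n ^ (r + 1)"
    using P.expectation_bound[OF rP] unfolding eP_def by blast
  obtain K3 N3 where b3: "\<And>n. n \<ge> N3 \<Longrightarrow> eZ n \<le> 1 / real n ^ (2 * r) + K3 / real n ^ (r + 1)"
    using P.expectation_pairs_bound[OF connP leaf rP] unfolding eZ_def by blast
  define pb where "pb n = measure_pmf.prob (random_graph n d) {G. occurs_in T G}" for n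
  \<comment> \<open>If \<open>X\<close> and \<open>Y\<close> count the occurrences of
    \<open>T\<close> and \<open>P\<close>, the indicator of \<open>X > 0\<close> is at least that of
    \<open>Y > 0\<close> minus \<open>Y - X\<close>. Bonferroni bounds the indicator of
    \<open>Y > 0\<close>, and taking expectations gives the claim.\<close>
  have pb: "eP n / real c - eZ n / (2 * real c ^ 2) - (eP n - eT n) \<le> pb n" for n
  proof -
    let ?M = "random_perms n d"
    have int: "integrable ?M h" for h :: "_ \<Rightarrow> real"
      by (rule integrable_measure_pmf_finite[OF finite_set_random_perms])
    have "eP n / real c - eZ n / (2 * real c ^ 2) - (eP n - eT n) =
      measure_pmf.expectation ?M (\<lambda>p. real (card (occ_maps n p P)) / real c
        - real (card (occ_pairs n p P)) / (2 * real c ^ 2)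
        - (real (card (occ_maps n p P)) - real (card (occ_maps n p T))))"
      unfolding eT_def eP_def eZ_def
      by (simp add: int Bochner_Integration.integral_diff)
    also have "\<dots> \<le> measure_pmf.expectation ?M (indicator {p. occurs_in T (perm_graph n d p)})"
    proof (rule integral_mono_AE[OF int int], unfold AE_measure_pmf_iff, rule ballI)
      fix p assume "p \<in> set_pmf ?M"
      then have perm: "p j permutes {1..n}" for j by (rule permutes_random_perms)
      have le: "card (occ_maps n p T) \<le> card (occ_maps n p P)"
        by (rule T.card_occ_maps_subgraph[OF conn perm sub])
          (use connP P.finite_verts in \<open>auto simp: conn_def P.wf_digraph_axioms\<close>)
      have occ: "occurs_in T (perm_graph n d p) \<longleftrightarrow> occ_maps n p T \<noteq> {}"
        using T.occurrences_perm_graph_iff[of p n, OF perm]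
        by (auto simp: occurs_in_def)
      have fin: "finite (occ_maps n p T)" "finite (occ_maps n p P)"
        by (simp_all add: finite_occ_maps T.finite_verts P.finite_verts)
      show "real (card (occ_maps n p P)) / real c - real (card (occ_pairs n p P)) / (2 * real c ^ 2)
          - (real (card (occ_maps n p P)) - real (card (occ_maps n p T)))
        \<le> indicator {p. occurs_in T (perm_graph n d p)} p"
      \<comment> \<open>If \<open>T\<close> does not occur, the correction \<open>Y - X\<close>
        equals \<open>Y\<close> and absorbs the indicator of \<open>Y > 0\<close>. If
        \<open>T\<close> occurs, the correction is nonnegative and the indicator is at most
        1.\<close>
      proof (cases "occ_maps n p T = {}")
        case True
        have "(if occ_maps n p P = {} then 0 else 1) \<le> real (card (occ_maps n p P))"
          using fin(2) by (auto simp: Suc_le_eq card_gt_0_iff)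
        then show ?thesis using P.bonferroni_occ[of n p] True occ by (simp add: c)
      next
        case False
        have "(if occ_maps n p P = {} then 0 else 1) \<le> (1 :: real)" by simp
        then show ?thesis using P.bonferroni_occ[of n p] False occ le by (simp add: c)
      qed
    qed
    also have "\<dots> = pb n"
      by (simp add: pb_def random_graph_random_perms vimage_def)
    finally show ?thesis .
  qed
  define main where "main n = (1 / real n ^ r) / real c - (1 / real n ^ (2 * r)) / (2 * real c ^ 2)" for n
  \<comment> \<open>Taking the negative part makes the inequality hold for every \<open>n\<close>,
    while its size is controlled by a lower bound on \<open>pb n - main n\<close> alone.\<close>
  define h where "h n = min 0 (pb n - main n)" for n
  \<comment> \<open>The summands stem, in order, from the first moment of \<open>P\<close>, from the
    pairs, and from the two expectations in \<open>eP n - eT n\<close>.\<close>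
  define K where "K = K2 / real c + K3 / (2 * real c ^ 2) + K2 + K1"
  have "norm (h n) \<le> \<bar>K\<bar> * norm (1 / real n ^ (r + 1))" if n: "n \<ge> N1 + N2 + N3" for n
  proof -
    note B = b1[of n] b2[of n] b3[of n]
    have "(1 / real n ^ r - K2 / real n ^ (r + 1)) / real c \<le> eP n / real c"
      using B n by (intro divide_right_mono) auto
    moreover have "eZ n / (2 * real c ^ 2) \<le> (1 / real n ^ (2 * r) + K3 / real n ^ (r + 1)) / (2 * real c ^ 2)"
      using B n by (intro divide_right_mono) auto
    moreover have "eP n - eT n \<le> K2 / real n ^ (r + 1) + K1 / real n ^ (r + 1)"
      using B n by (simp add: abs_le_iff)
    moreover have "K / real n ^ (r + 1) = (K2 / real n ^ (r + 1)) / real c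
        + (K3 / real n ^ (r + 1)) / (2 * real c ^ 2) + K2 / real n ^ (r + 1) + K1 / real n ^ (r + 1)"
      by (simp add: K_def add_divide_distrib mult_ac)
    ultimately have low: "- (K / real n ^ (r + 1)) \<le> pb n - main n"
      using pb[of n] by (simp add: main_def add_divide_distrib diff_divide_distrib)
    moreover have "K / real n ^ (r + 1) \<le> \<bar>K\<bar> / real n ^ (r + 1)"
      by (intro divide_right_mono) auto
    moreover have "0 \<le> \<bar>K\<bar> / real n ^ (r + 1)" by simp
    ultimately show ?thesis by (simp add: h_def min_def)
  qed
  then have "h \<in> O(\<lambda>n. 1 / real n ^ (r + 1))"
    by (intro bigoI[where c = "\<bar>K\<bar>"]) (auto simp: eventually_at_top_linorder)
  moreover have "main n + h n \<le> pb n" for n by (simp add: h_def)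
  ultimately show "\<exists>h \<in> O(\<lambda>n. 1 / real n ^ (r + 1)). \<forall>n \<ge> 1.
      measure_pmf.prob (random_graph n d) {G. occurs_in T G}
        \<ge> (1 / real n ^ r) / real c - (1 / real n ^ (2 * r)) / (2 * real c ^ 2) + h n"
    unfolding main_def pb_def by blast
qed

end
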